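(* Let $X$ be a complex Banach space and $T\in\mathcal{B}(X)$. Then the following statements are equivalent: (i) There exists $S_2\in\mathcal{B}(X)$ such that $TS_2T=T^2S_2$, $TS_2^2=S_2$, and $TS_2T-T$ is quasi-nilpotent. (ii) There exists a projection $P\in\mathcal{B}(X)$ such that $TP=PT$, $T+P$ is right invertible and $TP$ is quasi-nilpotent. (iii) $K(T)$ is topologically complemented in $X$ with a closed subspace $N$ (that is, $X=K(T)\oplus N$ with both summands closed) such that $\mathcal{R}(T|_N)\subseteq N\subseteq H_0(T)$, and $\mathcal{N}(T)\cap K(T)$ is topologically complemented in $K(T)$. (iv) There exists a closed subspace $N$ such that $X=K(T)\oplus N$, $T|_{K(T)}$ is right invertible and $T|_N$ is quasi-nilpotent, where $K(T)$ and $N$ reduce $T$. (v) There exist two closed subspaces $M$ and $N$ reducing $T$ such that $T|_M$ is right invertible and $T|_N$ is quasi-nilpotent.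
   Context: $\mathcal{B}(X)$ is the algebra of bounded linear operators on $X$; $\mathcal{N}(T)$ and $\mathcal{R}(T)$ are the null space and range of $T$. An operator $A$ on a Banach space is quasi-nilpotent if $\lim_{n\to\infty}\|A^n\|^{1/n}=0$. A projection is an idempotent in $\mathcal{B}(X)$. An operator $A\in\mathcal{B}(Y)$ is right invertible if there is $B\in\mathcal{B}(Y)$ with $AB=I$. The quasi-nilpotent part of $T$ is $H_0(T)=\{x\in X:\lim_{n\to\infty}\|T^nx\|^{1/n}=0\}$. The analytical core $K(T)$ is the set of $x\in X$ for which there are a sequence $(u_n)_{n\ge 0}$ in $X$ and a constant $\delta>0$ such that $x=u_0$, $Tu_{n+1}=u_n$ for all $n\ge 0$, and $\|u_n\|\le\delta^n\|x\|$ for all $n\ge1$. Closed subspaces $M,N$ of $X$ reduce $T$ if $X=M\oplus N$ and both are invariant under $T$; then $T|_M\in\mathcal{B}(M)$, $T|_N\in\mathcal{B}(N)$ are the restrictions. A closed subspace is topologically complemented if it has a closed complement. *)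

theory Defs
  imports "HOL-Analysis.Analysis"
begin

section \<open>Complex Banach spaces\<close>

text \<open>The complex structure extends the real one of the library: real scalars act as \<open>scaleR\<close>,
  and the norm is absolutely homogeneous over the complex numbers.\<close>

class complex_normed_vector = real_normed_vector +
  fixes scaleC :: "complex \<Rightarrow> 'a \<Rightarrow> 'a" (infixr "*\<^sub>C" 75)
  assumes scaleC_add_right: "a *\<^sub>C (x + y) = a *\<^sub>C x + a *\<^sub>C y"
    and scaleC_add_left: "(a + b) *\<^sub>C x = a *\<^sub>C x + b *\<^sub>C x"
    and scaleC_scaleC: "a *\<^sub>C (b *\<^sub>C x) = (a * b) *\<^sub>C x"
    and scaleC_of_real: "complex_of_real r *\<^sub>C x = r *\<^sub>R x"
    and norm_scaleC: "norm (a *\<^sub>C x) = cmod a * norm x"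

class complex_banach = complex_normed_vector + banach

global_interpretation complex_vector: vector_space "scaleC :: complex \<Rightarrow> 'a \<Rightarrow> 'a::complex_normed_vector"
  by unfold_locales
    (simp_all add: scaleC_add_right scaleC_add_left scaleC_scaleC
      scaleC_of_real [of 1, simplified])

instantiation complex :: complex_banach
begin

definition scaleC_complex :: "complex \<Rightarrow> complex \<Rightarrow> complex"
  where "scaleC_complex a x = a * x"

instance
  by standard (simp_all add: scaleC_complex_def algebra_simps norm_mult scaleR_conv_of_real)

end

definition closed_csubspace :: "'a::complex_normed_vector set \<Rightarrow> bool"
  where "closed_csubspace M \<longleftrightarrow> complex_vector.subspace M \<and> closed M"


section \<open>Bounded operators on a subspace\<close>

text \<open>A subspace is not a type, so an operator on a subspace \<open>M\<close> is represented by a function on the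
  whole space of which only the values on \<open>M\<close> matter. In particular the restriction of \<open>T\<close> to an
  invariant subspace is represented by \<open>T\<close> itself, and \<open>M = UNIV\<close> gives operators on the whole
  space.\<close>

definition bounded_ops :: "'a::complex_normed_vector set \<Rightarrow> ('a \<Rightarrow> 'a) set"
  where "bounded_ops M = {A. A ` M \<subseteq> M
    \<and> (\<forall>x\<in>M. \<forall>y\<in>M. A (x + y) = A x + A y)
    \<and> (\<forall>c. \<forall>x\<in>M. A (c *\<^sub>C x) = c *\<^sub>C A x)
    \<and> (\<exists>K. \<forall>x\<in>M. norm (A x) \<le> norm x * K)}"

lemma bounded_ops_UNIV:
  "A \<in> bounded_ops UNIV \<longleftrightarrow> bounded_linear A \<and> (\<forall>c x. A (c *\<^sub>C x) = c *\<^sub>C A x)"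
proof
  assume A: "A \<in> bounded_ops UNIV"
  then obtain K where K: "\<And>x. norm (A x) \<le> norm x * K"
    by (auto simp: bounded_ops_def)
  have "A (r *\<^sub>R x) = r *\<^sub>R A x" for r x
    using A by (simp add: bounded_ops_def flip: scaleC_of_real)
  then have "bounded_linear A"
    using A K by (intro bounded_linear_intro [where K = K]) (auto simp: bounded_ops_def)
  then show "bounded_linear A \<and> (\<forall>c x. A (c *\<^sub>C x) = c *\<^sub>C A x)"
    using A by (simp add: bounded_ops_def)
next
  assume "bounded_linear A \<and> (\<forall>c x. A (c *\<^sub>C x) = c *\<^sub>C A x)"
  then show "A \<in> bounded_ops UNIV"
    by (auto simp: bounded_ops_def linear_simps dest: bounded_linear.bounded)
qed

text \<open>The operator norm of the restriction to \<open>M\<close>, defined like \<open>onorm\<close>; as there, \<open>x = 0\<close>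
  contributes the value \<open>0 / 0 = 0\<close>.\<close>

definition onorm_on :: "'a::real_normed_vector set \<Rightarrow> ('a \<Rightarrow> 'a) \<Rightarrow> real"
  where "onorm_on M A = (SUP x\<in>M. norm (A x) / norm x)"

lemma onorm_on_UNIV: "onorm_on UNIV A = onorm A"
  by (simp add: onorm_on_def onorm_def)

definition quasi_nilpotent_on :: "'a::real_normed_vector set \<Rightarrow> ('a \<Rightarrow> 'a) \<Rightarrow> bool"
  where "quasi_nilpotent_on M A \<longleftrightarrow> (\<lambda>n. root n (onorm_on M (A ^^ n))) \<longlonglongrightarrow> 0"

definition right_invertible_on :: "'a::complex_normed_vector set \<Rightarrow> ('a \<Rightarrow> 'a) \<Rightarrow> bool"
  where "right_invertible_on M A \<longleftrightarrow> (\<exists>B\<in>bounded_ops M. \<forall>x\<in>M. A (B x) = x)"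

abbreviation quasi_nilpotent :: "('a::real_normed_vector \<Rightarrow> 'a) \<Rightarrow> bool"
  where "quasi_nilpotent A \<equiv> quasi_nilpotent_on UNIV A"

abbreviation right_invertible :: "('a::complex_normed_vector \<Rightarrow> 'a) \<Rightarrow> bool"
  where "right_invertible A \<equiv> right_invertible_on UNIV A"

definition projection :: "('a::complex_normed_vector \<Rightarrow> 'a) \<Rightarrow> bool"
  where "projection P \<longleftrightarrow> P \<in> bounded_ops UNIV \<and> P \<circ> P = P"


section \<open>Topological direct sums and reducing subspaces\<close>

text \<open>\<open>Y = M \<oplus> N\<close> with both summands closed subspaces.\<close>

definition top_direct_sum ::
    "'a::complex_normed_vector set \<Rightarrow> 'a set \<Rightarrow> 'a set \<Rightarrow> bool"
  where "top_direct_sum Y M N \<longleftrightarrow> closed_csubspace M \<and> closed_csubspace N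
    \<and> M \<inter> N = {0} \<and> Y = {x + y |x y. x \<in> M \<and> y \<in> N}"

definition top_complemented_in :: "'a::complex_normed_vector set \<Rightarrow> 'a set \<Rightarrow> bool"
  where "top_complemented_in Y M \<longleftrightarrow> (\<exists>N. top_direct_sum Y M N)"

definition reduces :: "('a::complex_normed_vector \<Rightarrow> 'a) \<Rightarrow> 'a set \<Rightarrow> 'a set \<Rightarrow> bool"
  where "reduces T M N \<longleftrightarrow> top_direct_sum UNIV M N \<and> T ` M \<subseteq> M \<and> T ` N \<subseteq> N"


section \<open>Null space, quasi-nilpotent part and analytical core\<close>

definition null_space :: "('a \<Rightarrow> 'a::zero) \<Rightarrow> 'a set"
  where "null_space T = {x. T x = 0}"

definition quasi_nilpotent_part :: "('a::real_normed_vector \<Rightarrow> 'a) \<Rightarrow> 'a set"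
  where "quasi_nilpotent_part T = {x. (\<lambda>n. root n (norm ((T ^^ n) x))) \<longlonglongrightarrow> 0}"

definition analytical_core :: "('a::real_normed_vector \<Rightarrow> 'a) \<Rightarrow> 'a set"
  where "analytical_core T = {x. \<exists>(u :: nat \<Rightarrow> 'a) \<delta>. \<delta> > 0 \<and> x = u 0
    \<and> (\<forall>n. T (u (Suc n)) = u n) \<and> (\<forall>n\<ge>1. norm (u n) \<le> \<delta> ^ n * norm x)}"


section \<open>Equivalence of a list of statements\<close>

definition all_equivalent :: "bool list \<Rightarrow> bool"
  where "all_equivalent ps \<longleftrightarrow> (\<forall>p\<in>set ps. \<forall>q\<in>set ps. p \<longleftrightarrow> q)"

end

theory Submission
  imports Defs
begin

text \<open>
  All conditions are compared with the existence of a reducing pair \<open>M\<close>, \<open>N\<close> as in the last one. Such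
  a pair is the same as a projection \<open>P\<close> commuting with \<open>T\<close>, with kernel \<open>M\<close> and range \<open>N\<close>; its
  boundedness is the closed graph theorem. If \<open>B\<close> is a right inverse of \<open>T\<close> on \<open>M\<close>, then
  \<open>S = B (I - P)\<close> satisfies the first condition; conversely, the equations for \<open>S\<close> say that \<open>T S\<close> is an
  idempotent commuting with \<open>T\<close>, and \<open>P = I - T S\<close>. The operator \<open>T + P\<close> is \<open>T\<close> on \<open>M\<close> and \<open>T + I\<close> on
  \<open>N\<close>, where the latter is inverted by a Neumann series. If \<open>u\<close> is a backward orbit of \<open>x\<close> of at most
  exponential growth, then \<open>P x = T\<^sup>n (P u\<^sub>n)\<close> tends to \<open>0\<close>, which forces \<open>M = K(T)\<close>. Finally, \<open>T\<close> maps
  \<open>K(T)\<close> onto itself, so by the closed graph theorem it is right invertible there as soon as its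
  kernel is complemented, and by uniform boundedness pointwise quasi-nilpotence on \<open>N\<close> is uniform.
\<close>

section \<open>Boundedness theorems on closed subspaces\<close>

text \<open>Zabreiko's lemma. The closed graph theorem and the uniform boundedness principle are the cases
  \<open>p x = norm (S x)\<close> and \<open>p x = (SUP n. norm (A n x))\<close>.\<close>

lemma countably_subadditive_seminorm_bounded:
  fixes p :: "'a::banach \<Rightarrow> real"
  assumes Y: "subspace Y" "closed Y"
    and nonneg: "\<And>x. x \<in> Y \<Longrightarrow> 0 \<le> p x"
    and scale: "\<And>c x. x \<in> Y \<Longrightarrow> p (c *\<^sub>R x) = \<bar>c\<bar> * p x"
    and subadd: "\<And>f x. (\<And>n. f n \<in> Y) \<Longrightarrow> f sums x \<Longrightarrow> summable (\<lambda>n. p (f n))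
      \<Longrightarrow> p x \<le> (\<Sum>n. p (f n))"
  obtains K where "K \<ge> 0" "\<And>x. x \<in> Y \<Longrightarrow> p x \<le> norm x * K"
proof -
  have p0: "p 0 = 0"
    using scale [of 0 0] Y by (simp add: subspace_0)
  have add: "p (x + y) \<le> p x + p y" if "x \<in> Y" "y \<in> Y" for x y
  proof -
    \<comment> \<open>Finite subadditivity is countable subadditivity for the series x + y + 0 + 0 +
      ...\<close>
    define f where "f n = (if n = 0 then x else if n = Suc 0 then y else 0)" for n
    have f: "f sums (x + y)"
      using sums_finite [of "{0, Suc 0}" f] by (simp add: f_def)
    have pf: "(\<lambda>n. p (f n)) sums (p x + p y)"
      using sums_finite [of "{0, Suc 0}" "\<lambda>n. p (f n)"] by (simp add: f_def p0)
    have "f n \<in> Y" for n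
      using that Y by (simp add: f_def subspace_0)
    then have "p (x + y) \<le> (\<Sum>n. p (f n))"
      by (rule subadd [OF _ f sums_summable [OF pf]])
    then show ?thesis
      using sums_unique [OF pf] by simp
  qed
  \<comment> \<open>The closures of the sublevel sets cover the complete space \<open>Y\<close>, so
    by Baire one of them has nonempty interior relative to \<open>Y\<close>.\<close>
  define L where "L k = {x \<in> Y. p x \<le> real k}" for k
  have LY: "closure (L k) \<subseteq> Y" for k
    using Y by (intro closure_minimal) (auto simp: L_def)
  have cover: "(\<Union>k. closure (L k)) = Y"
  proof
    show "Y \<subseteq> (\<Union>k. closure (L k))"
    proof
      fix x assume "x \<in> Y"
      then have "x \<in> L (nat \<lceil>p x\<rceil>)"
        by (simp add: L_def of_nat_ceiling)
      then show "x \<in> (\<Union>k. closure (L k))"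
        using closure_subset by blast
    qed
  qed (use LY in blast)
  let ?Y = "top_of_set Y"
  have "\<exists>k. ?Y interior_of closure (L k) \<noteq> {}"
  proof (rule ccontr)
    assume *: "\<nexists>k. ?Y interior_of closure (L k) \<noteq> {}"
    have "?Y interior_of \<Union>(range (\<lambda>k. closure (L k))) = {}"
    proof (rule Baire_category_alt)
      show "completely_metrizable_space ?Y \<or> locally_compact_space ?Y \<and> regular_space ?Y"
        using Y by (simp add: completely_metrizable_space_closedin completely_metrizable_space_euclidean)
      show "closedin ?Y S \<and> ?Y interior_of S = {}" if "S \<in> range (\<lambda>k. closure (L k))" for S
        using that * LY closed_subset [OF _ closed_closure] by blast
    qed auto
    then have "?Y interior_of Y = {}"
      by (simp add: cover)
    then show False
      using interior_of_topspace [of ?Y] Y(1) subspace_0 by auto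
  qed
  then obtain k a where "a \<in> ?Y interior_of closure (L k)"
    by blast
  then obtain U where U: "openin ?Y U" "a \<in> U" "U \<subseteq> closure (L k)"
    by (auto simp: interior_of_def)
  then obtain r where r: "r > 0" and ball: "\<And>x. x \<in> Y \<Longrightarrow> dist x a < r \<Longrightarrow> x \<in> closure (L k)" and aY: "a \<in> Y"
    by (meson openin_euclidean_subtopology_iff subset_iff)
  \<comment> \<open>Sublevel sets are symmetric and convex, and x is half the difference of a + x
    and a - x. Hence the ball around \<open>a\<close> can be moved to the origin with the same level
    \<open>k\<close>.\<close>
  have near: "x \<in> closure (L k)" if x: "x \<in> Y" "norm x < r" for x
  proof (unfold closure_approachable, intro allI impI)
    fix e :: real assume "e > 0"
    have "a + x \<in> closure (L k)" "a - x \<in> closure (L k)"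
      using x aY Y by (auto intro!: ball simp: subspace_add subspace_diff dist_norm)
    then obtain y z where yz: "y \<in> L k" "dist y (a + x) < e" "z \<in> L k" "dist z (a - x) < e"
      using \<open>e > 0\<close> unfolding closure_approachable by meson
    let ?w = "(1/2) *\<^sub>R y + (- (1/2)) *\<^sub>R z"
    have "p ?w \<le> p ((1/2) *\<^sub>R y) + p ((- (1/2)) *\<^sub>R z)"
      using yz Y by (intro add) (auto simp: L_def subspace_scale subspace_neg)
    also have "\<dots> \<le> k"
      using yz by (simp only: scale L_def mem_Collect_eq) simp
    finally have "?w \<in> L k"
      using yz Y by (auto simp: L_def subspace_scale subspace_neg subspace_diff)
    moreover have "?w - x = (1/2) *\<^sub>R ((y - (a + x)) - (z - (a - x)))"
      by (simp add: algebra_simps) (simp add: scaleR_add_left [symmetric] del: scaleR_add_left)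
    then have "norm (?w - x) \<le> (1/2) * (norm (y - (a + x)) + norm (z - (a - x)))"
      using norm_triangle_ineq4 [of "y - (a + x)" "z - (a - x)"] by simp
    then have "dist ?w x < e"
      using yz by (simp add: dist_norm)
    ultimately show "\<exists>w\<in>L k. dist w x < e"
      by blast
  qed
  \<comment> \<open>Scaling a nonzero x by 1/t with t = 2 norm x / r gives norm r/2, inside the
    ball. Approximating there and scaling back yields a vector whose \<open>p\<close> is at most c
    norm x, with error at most half the norm of x.\<close>
  define c where "c = 2 * real k / r"
  have c: "c \<ge> 0"
    using r by (simp add: c_def)
  have "\<exists>y. y \<in> Y \<and> p y \<le> c * norm x \<and> norm (x - y) \<le> norm x / 2" if x: "x \<in> Y" for x
  proof (cases "x = 0")
    case True
    then show ?thesis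
      using Y p0 by (intro exI [of _ 0]) (simp add: subspace_0)
  next
    case False
    define t where "t = 2 * norm x / r"
    have t: "t > 0"
      using False r by (simp add: t_def)
    have "norm ((1/t) *\<^sub>R x) < r"
      using False r by (simp add: t_def)
    then have "(1/t) *\<^sub>R x \<in> closure (L k)"
      using x Y by (intro near) (auto simp: subspace_scale)
    moreover have "norm x / (2 * t) > 0"
      using False t by simp
    ultimately obtain z where z: "z \<in> L k" "dist z ((1/t) *\<^sub>R x) < norm x / (2 * t)"
      unfolding closure_approachable by blast
    have "x - t *\<^sub>R z = t *\<^sub>R ((1/t) *\<^sub>R x - z)"
      using t by (simp add: algebra_simps)
    then have "norm (x - t *\<^sub>R z) = t * dist z ((1/t) *\<^sub>R x)"
      using t by (simp add: dist_norm norm_minus_commute)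
    also have "\<dots> \<le> norm x / 2"
      using z(2) t by (simp add: field_simps)
    finally have "norm (x - t *\<^sub>R z) \<le> norm x / 2" .
    moreover have "p (t *\<^sub>R z) \<le> c * norm x"
    proof -
      have "p (t *\<^sub>R z) = t * p z"
        using z t by (simp add: scale L_def)
      also have "\<dots> \<le> t * k"
        using z t by (intro mult_left_mono) (auto simp: L_def)
      finally show ?thesis
        by (simp add: t_def c_def mult_ac)
    qed
    ultimately show ?thesis
      using z Y by (intro exI [of _ "t *\<^sub>R z"]) (simp add: L_def subspace_scale)
  qed
  then obtain g where g: "\<And>x. x \<in> Y \<Longrightarrow> g x \<in> Y \<and> p (g x) \<le> c * norm x \<and> norm (x - g x) \<le> norm x / 2"
    by metis
  show thesis
  proof
    fix x assume x: "x \<in> Y"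
    \<comment> \<open>Approximating each remainder again halves it, so x is the telescoping sum of
      the approximants \<open>g (h n)\<close>; countable subadditivity and a geometric series then
      give the bound 2 c norm x.\<close>
    define h where "h n = ((\<lambda>x. x - g x) ^^ n) x" for n
    have h: "h n \<in> Y \<and> norm (h n) \<le> norm x * (1/2) ^ n" for n
    proof (induction n)
      case (Suc n)
      then have "norm (h n - g (h n)) \<le> norm (h n) / 2" "h n - g (h n) \<in> Y"
        using g Y by (auto simp: subspace_diff)
      then show ?case
        using Suc by (simp add: h_def)
    qed (use x in \<open>simp add: h_def\<close>)
    have "(\<lambda>n. norm x * (1/2) ^ n) \<longlonglongrightarrow> 0"
      by (intro tendsto_mult_right_zero LIMSEQ_power_zero) simp
    then have "h \<longlonglongrightarrow> 0"
      by (rule Lim_null_comparison [rotated]) (use h in simp)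
    then have "(\<lambda>n. h n - h (Suc n)) sums (h 0 - 0)"
      by (rule telescope_sums')
    then have sums: "(\<lambda>n. g (h n)) sums x"
      by (simp add: h_def)
    have geo: "(\<lambda>n. c * norm x * (1/2) ^ n) sums (c * norm x * 2)"
      using sums_mult [OF geometric_sums [of "1/2 :: real"]] by simp
    have le: "p (g (h n)) \<le> c * norm x * (1/2) ^ n" for n
    proof -
      have "p (g (h n)) \<le> c * norm (h n)"
        using g h by blast
      also have "\<dots> \<le> c * (norm x * (1/2) ^ n)"
        using h c by (intro mult_left_mono) auto
      finally show ?thesis
        by (simp add: mult_ac)
    qed
    have summable: "summable (\<lambda>n. p (g (h n)))"
      by (rule summable_comparison_test' [OF sums_summable [OF geo], of 0])
        (use le nonneg g h in auto)
    have "p x \<le> (\<Sum>n. p (g (h n)))"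
      using g h sums summable by (intro subadd) auto
    also have "\<dots> \<le> c * norm x * 2"
      using suminf_le [OF le summable sums_summable [OF geo]] sums_unique [OF geo] by simp
    finally show "p x \<le> norm x * (2 * c)"
      by (simp add: mult_ac)
  qed (use c in simp)
qed

lemma closed_graph_bounded:
  fixes S :: "'a::banach \<Rightarrow> 'b::banach"
  assumes Y: "subspace Y" "closed Y"
    and add: "\<And>x y. x \<in> Y \<Longrightarrow> y \<in> Y \<Longrightarrow> S (x + y) = S x + S y"
    and scale: "\<And>c x. x \<in> Y \<Longrightarrow> S (c *\<^sub>R x) = c *\<^sub>R S x"
    and graph: "\<And>f x y. (\<And>n. f n \<in> Y) \<Longrightarrow> f \<longlonglongrightarrow> x \<Longrightarrow> (\<lambda>n. S (f n)) \<longlonglongrightarrow> y \<Longrightarrow> S x = y"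
  obtains K where "K \<ge> 0" "\<And>x. x \<in> Y \<Longrightarrow> norm (S x) \<le> norm x * K"
proof (rule countably_subadditive_seminorm_bounded [OF Y, of "\<lambda>x. norm (S x)"])
  fix f x
  assume f: "\<And>n. f n \<in> Y" "f sums x" "summable (\<lambda>n. norm (S (f n)))"
  have "S 0 = 0"
    using scale [of 0 0] Y by (simp add: subspace_0)
  \<comment> \<open>The partial sums converge to x and their images converge absolutely, so the
    closed graph identifies \<open>S x\<close> with the sum of the images. This is countable
    subadditivity of \<open>norm (S x)\<close>.\<close>
  then have "S (\<Sum>i<n. f i) = (\<Sum>i<n. S (f i))" for n
    using f Y by (induction n) (auto simp: add subspace_sum)
  moreover have "(\<lambda>n. \<Sum>i<n. S (f i)) \<longlonglongrightarrow> (\<Sum>n. S (f n))"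
    by (rule summable_LIMSEQ [OF summable_norm_cancel [OF f(3)]])
  moreover have "(\<lambda>n. \<Sum>i<n. f i) \<longlonglongrightarrow> x"
    using f(2) by (simp add: sums_def)
  ultimately have "S x = (\<Sum>n. S (f n))"
    using f Y by (intro graph [of "\<lambda>n. \<Sum>i<n. f i"]) (auto intro: subspace_sum)
  then show "norm (S x) \<le> (\<Sum>n. norm (S (f n)))"
    using summable_norm [OF f(3)] by simp
qed (auto simp: scale)

lemma uniform_boundedness_on:
  fixes A :: "nat \<Rightarrow> 'a::banach \<Rightarrow> 'b::banach"
  assumes Y: "subspace Y" "closed Y"
    and lin: "\<And>n. bounded_linear (A n)"
    and pointwise: "\<And>x. x \<in> Y \<Longrightarrow> \<exists>C. \<forall>n. norm (A n x) \<le> C"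
  obtains K where "K \<ge> 0" "\<And>x n. x \<in> Y \<Longrightarrow> norm (A n x) \<le> norm x * K"
proof -
  define p where "p x = (SUP n. norm (A n x))" for x
  have bdd: "bdd_above (range (\<lambda>n. norm (A n x)))" if "x \<in> Y" for x
    using pointwise [OF that] by (auto simp: bdd_above_def)
  have le: "norm (A n x) \<le> p x" if "x \<in> Y" for n x
    unfolding p_def using bdd [OF that] by (intro cSUP_upper) auto
  \<comment> \<open>Applied to \<open>inverse c\<close>, this inequality yields its own reverse,
    hence homogeneity.\<close>
  have scale_le: "p (c *\<^sub>R x) \<le> \<bar>c\<bar> * p x" if x: "x \<in> Y" for c x
    unfolding p_def [of "c *\<^sub>R x"]
  proof (rule cSUP_least)
    show "norm (A n (c *\<^sub>R x)) \<le> \<bar>c\<bar> * p x" for n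
      using le [OF x] by (simp add: linear_simps lin mult_left_mono)
  qed auto
  obtain K where "K \<ge> 0" "\<And>x. x \<in> Y \<Longrightarrow> p x \<le> norm x * K"
  proof (rule countably_subadditive_seminorm_bounded [OF Y, of p])
    show "0 \<le> p x" if "x \<in> Y" for x
      using le [OF that] norm_ge_zero order_trans by blast
    show "p (c *\<^sub>R x) = \<bar>c\<bar> * p x" if x: "x \<in> Y" for c x
    proof (cases "c = 0")
      case True
      then show ?thesis
        by (simp add: p_def linear_simps lin)
    next
      case False
      have "p (inverse c *\<^sub>R (c *\<^sub>R x)) \<le> \<bar>inverse c\<bar> * p (c *\<^sub>R x)"
        using x Y by (intro scale_le) (auto simp: subspace_scale)
      then have "\<bar>c\<bar> * p x \<le> p (c *\<^sub>R x)"
        using False by (simp add: field_simps)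
      then show ?thesis
        using scale_le [OF x] by (simp add: antisym)
    qed
    show "p x \<le> (\<Sum>n. p (f n))"
      if f: "\<And>n. f n \<in> Y" "f sums x" "summable (\<lambda>n. p (f n))" for f x
      unfolding p_def [of x]
    proof (rule cSUP_least)
      fix n
      \<comment> \<open>Each single \<open>A n\<close> is continuous, so it is summed termwise
        before the supremum over n is taken.\<close>
      have "(\<lambda>k. A n (f k)) sums A n x"
        by (rule bounded_linear.sums [OF lin f(2)])
      then show "norm (A n x) \<le> (\<Sum>k. p (f k))"
        by (rule norm_sums_le [OF _ summable_sums [OF f(3)]]) (use le f in blast)
    qed auto
  qed auto
  then show thesis
    using that le order_trans by meson
qed

section \<open>Quasi-nilpotent operators on a subspace\<close>

text \<open>Replaces limits of roots by geometric bounds at every rate, which are easier to combine.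
  The constant absorbs finitely many initial terms, including index 0, where \<open>root 0\<close>
  is 0.\<close>

lemma root_tendsto_0_iff:
  fixes a :: "nat \<Rightarrow> real"
  assumes nonneg: "\<And>n. 0 \<le> a n"
  shows "(\<lambda>n. root n (a n)) \<longlonglongrightarrow> 0 \<longleftrightarrow> (\<forall>\<epsilon>>0. \<exists>C. \<forall>n. a n \<le> C * \<epsilon> ^ n)"
proof (intro iffI allI impI)
  fix \<epsilon> :: real
  assume lim: "(\<lambda>n. root n (a n)) \<longlonglongrightarrow> 0" and \<epsilon>: "\<epsilon> > 0"
  then obtain m where m: "\<And>n. n \<ge> m \<Longrightarrow> root n (a n) < \<epsilon>"
    using order_tendstoD(2) [OF lim \<epsilon>] by (auto simp: eventually_sequentially)
  \<comment> \<open>The sum dominates each of the initial quotients, and the summand 1 covers the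
    tail.\<close>
  define C where "C = 1 + (\<Sum>n\<le>m. a n / \<epsilon> ^ n)"
  have "a n \<le> C * \<epsilon> ^ n" for n
  proof (cases "n \<le> m")
    case True
    have "a n / \<epsilon> ^ n \<le> (\<Sum>n\<le>m. a n / \<epsilon> ^ n)"
      using True nonneg \<epsilon> by (intro member_le_sum) auto
    then have "a n / \<epsilon> ^ n \<le> C"
      by (simp add: C_def)
    then show ?thesis
      using \<epsilon> by (simp add: field_simps)
  next
    case False
    have "a n = root n (a n) ^ n"
      using False nonneg by simp
    also have "\<dots> \<le> \<epsilon> ^ n"
      using False m [of n] nonneg by (intro power_mono) auto
    also have "\<dots> \<le> C * \<epsilon> ^ n"
      using \<epsilon> nonneg by (simp add: C_def sum_nonneg)
    finally show ?thesis .
  qed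
  then show "\<exists>C. \<forall>n. a n \<le> C * \<epsilon> ^ n"
    by blast
next
  assume bound: "\<forall>\<epsilon>>0. \<exists>C. \<forall>n. a n \<le> C * \<epsilon> ^ n"
  show "(\<lambda>n. root n (a n)) \<longlonglongrightarrow> 0"
  proof (rule order_tendstoI)
    fix e :: real assume "e < 0"
    then show "\<forall>\<^sub>F n in sequentially. e < root n (a n)"
      using nonneg by (intro always_eventually allI) (meson less_le_trans real_root_ge_zero)
  next
    fix e :: real assume e: "0 < e"
    then obtain C where C: "\<And>n. a n \<le> C * (e/2) ^ n"
      using bound by (meson half_gt_zero)
    \<comment> \<open>Roots of a positive constant tend to 1, so they are eventually below 2, which
      the rate e/2 compensates.\<close>
    have "(\<lambda>n. root n (max C 1)) \<longlonglongrightarrow> 1"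
      by (rule LIMSEQ_root_const) simp
    then have "\<forall>\<^sub>F n in sequentially. root n (max C 1) < 2"
      by (rule order_tendstoD) simp
    then show "\<forall>\<^sub>F n in sequentially. root n (a n) < e"
      using eventually_gt_at_top [of 0]
    proof eventually_elim
      case (elim n)
      have "a n \<le> max C 1 * (e/2) ^ n"
        using e by (intro order_trans [OF C] mult_right_mono) auto
      then have "root n (a n) \<le> root n (max C 1 * (e/2) ^ n)"
        using elim by simp
      also have "\<dots> = root n (max C 1) * (e/2)"
        using elim e by (simp add: real_root_mult real_root_power_cancel)
      also have "\<dots> < 2 * (e/2)"
        using elim e by (intro mult_strict_right_mono) auto
      finally show ?case
        by simp
    qed
  qed
qed

section \<open>Algebra of bounded operators on a subspace\<close>

lemma bounded_linear_scaleC: "bounded_linear (\<lambda>x. c *\<^sub>C (x :: 'a::complex_normed_vector))"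
proof (rule bounded_linear_intro [where K = "cmod c"])
  show "c *\<^sub>C (r *\<^sub>R x) = r *\<^sub>R (c *\<^sub>C x)" for r and x :: 'a
    by (simp add: scaleC_scaleC mult.commute flip: scaleC_of_real)
qed (simp_all add: scaleC_add_right norm_scaleC)

lemma csubspace_imp_subspace:
  fixes M :: "'a::complex_normed_vector set"
  assumes "complex_vector.subspace M"
  shows "subspace M"
  using assms by (simp add: complex_vector.subspace_def subspace_def flip: scaleC_of_real)

lemma closed_csubspace_imp_subspace: "closed_csubspace M \<Longrightarrow> subspace M"
  by (simp add: closed_csubspace_def csubspace_imp_subspace)

lemma bounded_opsD:
  assumes "A \<in> bounded_ops M"
  shows "x \<in> M \<Longrightarrow> A x \<in> M"
    and "x \<in> M \<Longrightarrow> y \<in> M \<Longrightarrow> A (x + y) = A x + A y"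
    and "x \<in> M \<Longrightarrow> A (c *\<^sub>C x) = c *\<^sub>C A x"
  using assms by (auto simp: bounded_ops_def)

lemma bounded_ops_bound:
  assumes "A \<in> bounded_ops M"
  obtains K where "K \<ge> 0" "\<And>x. x \<in> M \<Longrightarrow> norm (A x) \<le> K * norm x"
proof -
  obtain K where K: "\<And>x. x \<in> M \<Longrightarrow> norm (A x) \<le> norm x * K"
    using assms unfolding bounded_ops_def by blast
  have "norm (A x) \<le> max K 0 * norm x" if "x \<in> M" for x
    using K [OF that] by (metis max.cobounded1 mult.commute mult_left_mono norm_ge_zero order_trans)
  then show thesis
    using that [of "max K 0"] by simp
qed

lemma bounded_ops_zero: "A \<in> bounded_ops M \<Longrightarrow> 0 \<in> M \<Longrightarrow> A 0 = 0"
  using bounded_opsD(3) [of A M 0 0] by simp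

lemma bounded_ops_restrict: "A \<in> bounded_ops M \<Longrightarrow> N \<subseteq> M \<Longrightarrow> A ` N \<subseteq> N \<Longrightarrow> A \<in> bounded_ops N"
  unfolding bounded_ops_def by blast

text \<open>Two domains are allowed so that a right inverse \<open>A\<close> known only on a summand
  \<open>M\<close> can be composed with a projection \<open>B\<close> of the whole space into
  \<open>M\<close>.\<close>

lemma bounded_ops_comp:
  assumes A: "A \<in> bounded_ops M" and B: "B \<in> bounded_ops N" and "M \<subseteq> N" "B ` N \<subseteq> M"
  shows "(\<lambda>x. A (B x)) \<in> bounded_ops N"
proof -
  have BM: "B x \<in> M" if "x \<in> N" for x
    using assms that by blast
  obtain K L where K: "K \<ge> 0" "\<And>x. x \<in> M \<Longrightarrow> norm (A x) \<le> K * norm x"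
    and L: "L \<ge> 0" "\<And>x. x \<in> N \<Longrightarrow> norm (B x) \<le> L * norm x"
    using bounded_ops_bound [OF A] bounded_ops_bound [OF B] by metis
  have "norm (A (B x)) \<le> norm x * (K * L)" if "x \<in> N" for x
    using K(2) [OF BM [OF that]] mult_left_mono [OF L(2) [OF that] K(1)] by (simp add: mult_ac)
  moreover have "(\<lambda>x. A (B x)) ` N \<subseteq> N"
    using BM bounded_opsD(1) [OF A] \<open>M \<subseteq> N\<close> by blast
  ultimately show ?thesis
    using bounded_opsD(2,3) [OF A] bounded_opsD(2,3) [OF B] BM
    unfolding bounded_ops_def by auto
qed

lemma bounded_ops_add:
  assumes M: "complex_vector.subspace M" and A: "A \<in> bounded_ops M" and B: "B \<in> bounded_ops M"
  shows "(\<lambda>x. A x + B x) \<in> bounded_ops M"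
proof -
  obtain K L where K: "K \<ge> 0" "\<And>x. x \<in> M \<Longrightarrow> norm (A x) \<le> K * norm x"
    and L: "L \<ge> 0" "\<And>x. x \<in> M \<Longrightarrow> norm (B x) \<le> L * norm x"
    using bounded_ops_bound [OF A] bounded_ops_bound [OF B] by metis
  have "norm (A x + B x) \<le> norm x * (K + L)" if "x \<in> M" for x
    using K(2) [OF that] L(2) [OF that] norm_triangle_ineq [of "A x" "B x"]
    by (simp add: algebra_simps)
  then show ?thesis
    using bounded_opsD [OF A] bounded_opsD [OF B] complex_vector.subspace_add [OF M]
    unfolding bounded_ops_def by (auto simp: scaleC_add_right)
qed

lemma bounded_ops_uminus:
  assumes M: "complex_vector.subspace M" and A: "A \<in> bounded_ops M"
  shows "(\<lambda>x. - A x) \<in> bounded_ops M"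
  using A complex_vector.subspace_neg [OF M] unfolding bounded_ops_def by auto

lemma bounded_ops_id: "(\<lambda>x. x) \<in> bounded_ops M"
  unfolding bounded_ops_def by (auto intro: exI [of _ 1])

lemma bounded_ops_diff:
  assumes M: "complex_vector.subspace M" and A: "A \<in> bounded_ops M" and B: "B \<in> bounded_ops M"
  shows "(\<lambda>x. A x - B x) \<in> bounded_ops M"
  using bounded_ops_add [OF M A bounded_ops_uminus [OF M B]] by simp

lemma bounded_ops_funpow:
  assumes A: "A \<in> bounded_ops M"
  shows "A ^^ n \<in> bounded_ops M"
proof (induction n)
  case 0
  show ?case
    using bounded_ops_id by (simp add: id_def)
next
  case (Suc n)
  have "(\<lambda>x. A ((A ^^ n) x)) \<in> bounded_ops M"
    using Suc bounded_opsD(1) [OF Suc] by (intro bounded_ops_comp [OF A]) auto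
  then show ?case
    by (simp add: comp_def)
qed

section \<open>Operator norm and growth of powers on a subspace\<close>

lemma bdd_above_onorm_on:
  assumes A: "A \<in> bounded_ops M"
  shows "bdd_above ((\<lambda>x. norm (A x) / norm x) ` M)"
proof -
  obtain K where K: "K \<ge> 0" "\<And>x. x \<in> M \<Longrightarrow> norm (A x) \<le> K * norm x"
    using bounded_ops_bound [OF A] by metis
  have "norm (A x) / norm x \<le> K" if "x \<in> M" for x
    using K that by (cases "x = 0") (auto simp: field_simps)
  then show ?thesis
    by (auto simp: bdd_above_def)
qed

lemma onorm_on_nonneg:
  assumes "A \<in> bounded_ops M" "0 \<in> M"
  shows "0 \<le> onorm_on M A"
  unfolding onorm_on_def
  using cSUP_upper [OF assms(2) bdd_above_onorm_on [OF assms(1)]] by simp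

text \<open>At x = 0 the quotient has the value 0, which is at most \<open>c\<close> because
  \<open>c\<close> is nonnegative, while the right-hand inequality holds because
  \<open>A 0 = 0\<close>.\<close>

lemma onorm_on_le_iff:
  assumes A: "A \<in> bounded_ops M" and "0 \<in> M" and "0 \<le> c"
  shows "onorm_on M A \<le> c \<longleftrightarrow> (\<forall>x\<in>M. norm (A x) \<le> c * norm x)"
proof -
  have "norm (A x) / norm x \<le> c \<longleftrightarrow> norm (A x) \<le> c * norm x" if "x \<in> M" for x
    using assms bounded_ops_zero [OF A] by (cases "x = 0") (auto simp: field_simps)
  then show ?thesis
    unfolding onorm_on_def using assms
    by (subst cSUP_le_iff) (auto intro: bdd_above_onorm_on)
qed

text \<open>The working form of quasi-nilpotence: the root criterion applied to the operator norms
  of the powers, with a constant uniform in x.\<close>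

lemma quasi_nilpotent_on_iff:
  assumes A: "A \<in> bounded_ops M" and "0 \<in> M"
  shows "quasi_nilpotent_on M A
    \<longleftrightarrow> (\<forall>\<epsilon>>0. \<exists>C. \<forall>n. \<forall>x\<in>M. norm ((A ^^ n) x) \<le> C * \<epsilon> ^ n * norm x)"
proof -
  have nonneg: "0 \<le> onorm_on M (A ^^ n)" for n
    by (intro onorm_on_nonneg bounded_ops_funpow assms)
  have iff: "onorm_on M (A ^^ n) \<le> c \<longleftrightarrow> (\<forall>x\<in>M. norm ((A ^^ n) x) \<le> c * norm x)" if "0 \<le> c" for n c
    by (intro onorm_on_le_iff bounded_ops_funpow assms that)
  have "(\<exists>C. \<forall>n. onorm_on M (A ^^ n) \<le> C * \<epsilon> ^ n)
    \<longleftrightarrow> (\<exists>C. \<forall>n. \<forall>x\<in>M. norm ((A ^^ n) x) \<le> C * \<epsilon> ^ n * norm x)" if \<epsilon>: "\<epsilon> > 0" for \<epsilon>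
  proof
    assume "\<exists>C. \<forall>n. onorm_on M (A ^^ n) \<le> C * \<epsilon> ^ n"
    then obtain C where C: "\<And>n. onorm_on M (A ^^ n) \<le> C * \<epsilon> ^ n"
      by blast
    then have "0 \<le> C * \<epsilon> ^ n" for n
      using nonneg order_trans by blast
    then show "\<exists>C. \<forall>n. \<forall>x\<in>M. norm ((A ^^ n) x) \<le> C * \<epsilon> ^ n * norm x"
      using C iff by blast
  next
    assume "\<exists>C. \<forall>n. \<forall>x\<in>M. norm ((A ^^ n) x) \<le> C * \<epsilon> ^ n * norm x"
    then obtain C where C: "\<And>n x. x \<in> M \<Longrightarrow> norm ((A ^^ n) x) \<le> C * \<epsilon> ^ n * norm x"
      by blast
    \<comment> \<open>\<open>C\<close> may be negative if \<open>M\<close> is trivial; the maximum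
      makes the bound admissible for the operator norm.\<close>
    have "norm ((A ^^ n) x) \<le> max C 0 * \<epsilon> ^ n * norm x" if "x \<in> M" for n x
      using \<epsilon> by (intro order_trans [OF C [OF that]] mult_right_mono) auto
    then have "onorm_on M (A ^^ n) \<le> max C 0 * \<epsilon> ^ n" for n
      using \<epsilon> by (subst iff) auto
    then show "\<exists>C. \<forall>n. onorm_on M (A ^^ n) \<le> C * \<epsilon> ^ n"
      by blast
  qed
  then show ?thesis
    unfolding quasi_nilpotent_on_def by (subst root_tendsto_0_iff [OF nonneg]) blast
qed

text \<open>Powers change only by a sign. It is needed because T S T - T equals -T P when P = I - T
  S.\<close>

lemma quasi_nilpotent_on_uminus:
  fixes A :: "'a::real_normed_vector \<Rightarrow> 'a"
  assumes "\<And>x. A (- x) = - A x"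
  shows "quasi_nilpotent_on M (\<lambda>x. - A x) \<longleftrightarrow> quasi_nilpotent_on M A"
proof -
  have "((\<lambda>x. - A x) ^^ n) x = (A ^^ n) x \<or> ((\<lambda>x. - A x) ^^ n) x = - (A ^^ n) x" for n x
    by (induction n) (auto simp: assms)
  then have "norm (((\<lambda>x. - A x) ^^ n) x) = norm ((A ^^ n) x)" for n x
    by (metis norm_minus_cancel)
  then show ?thesis
    by (simp add: quasi_nilpotent_on_def onorm_on_def)
qed

section \<open>Neumann series on an invariant subspace\<close>

lemma funpow_mem: "T ` M \<subseteq> M \<Longrightarrow> x \<in> M \<Longrightarrow> (T ^^ n) x \<in> M"
  by (induction n) auto

lemma bounded_linear_funpow:
  fixes T :: "'a::complex_normed_vector \<Rightarrow> 'a"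
  assumes "T \<in> bounded_ops UNIV"
  shows "bounded_linear (T ^^ n)"
  using bounded_ops_funpow [OF assms] bounded_ops_UNIV by blast

text \<open>The inverse of \<open>T + I\<close> is the Neumann series of \<open>- T\<close>.\<close>

lemma quasi_nilpotent_on_imp_right_invertible_add_id:
  fixes T :: "'a::complex_banach \<Rightarrow> 'a"
  assumes T: "T \<in> bounded_ops UNIV" and N: "closed_csubspace N" and inv: "T ` N \<subseteq> N"
    and qn: "quasi_nilpotent_on N T"
  shows "right_invertible_on N (\<lambda>x. T x + x)"
proof -
  have sub: "complex_vector.subspace N" and cl: "closed N"
    using N by (auto simp: closed_csubspace_def)
  have TN: "T \<in> bounded_ops N"
    using bounded_ops_restrict [OF T _ inv] by simp
  \<comment> \<open>Quasi-nilpotence at the rate 1/2 makes the Neumann series converge absolutely on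
    \<open>N\<close>.\<close>
  have "\<exists>C. \<forall>n. \<forall>x\<in>N. norm ((T ^^ n) x) \<le> C * (1/2) ^ n * norm x"
    using qn unfolding quasi_nilpotent_on_iff [OF TN complex_vector.subspace_0 [OF sub]]
    by (auto dest: spec [of _ "1/2"])
  then obtain C where C: "\<And>n x. x \<in> N \<Longrightarrow> norm ((T ^^ n) x) \<le> C * (1/2) ^ n * norm x"
    by blast
  define t where "t x n = (-1) ^ n *\<^sub>R (T ^^ n) x" for x n
  have geo: "(\<lambda>n. C * (1/2) ^ n * norm x) sums (C * 2 * norm x)" for x :: 'a
    using sums_mult2 [OF sums_mult [OF geometric_sums [of "1/2 :: real"]]] by simp
  have t_bound: "norm (t x n) \<le> C * (1/2) ^ n * norm x" if "x \<in> N" for x n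
    using C [OF that] by (simp add: t_def)
  have t_sum: "summable (t x)" if "x \<in> N" for x
    by (rule summable_comparison_test' [OF sums_summable [OF geo]]) (use t_bound that in blast)
  define D where "D x = (\<Sum>n. t x n)" for x
  have sums: "t x sums D x" if "x \<in> N" for x
    unfolding D_def by (rule summable_sums [OF t_sum [OF that]])
  have lin: "bounded_linear (T ^^ n)" for n
    by (rule bounded_linear_funpow [OF T])
  have D_eq: "D x = y" if "x \<in> N" "t x sums y" for x y
    using sums that sums_unique2 by blast
  have "D \<in> bounded_ops N"
    unfolding bounded_ops_def
  proof (intro CollectI conjI ballI allI)
    show "D ` N \<subseteq> N"
    proof clarify
      fix x assume x: "x \<in> N"
      have "t x n \<in> N" for n
        unfolding t_def using funpow_mem [OF inv x] csubspace_imp_subspace [OF sub]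
        by (simp add: subspace_scale)
      then have "(\<Sum>i<n. t x i) \<in> N" for n
        by (intro complex_vector.subspace_sum [OF sub])
      then show "D x \<in> N"
        using closed_sequentially [OF cl] sums [OF x] unfolding sums_def by metis
    qed
    fix x assume x: "x \<in> N"
    show "D (x + y) = D x + D y" if "y \<in> N" for y
    proof (rule D_eq)
      have "t (x + y) = (\<lambda>n. t x n + t y n)"
        by (simp add: t_def fun_eq_iff linear_simps lin scaleR_add_right)
      then show "t (x + y) sums (D x + D y)"
        using sums_add [OF sums [OF x] sums [OF that]] by simp
    qed (intro complex_vector.subspace_add [OF sub] x that)
    show "D (c *\<^sub>C x) = c *\<^sub>C D x" for c
    proof (rule D_eq)
      have "t (c *\<^sub>C x) = (\<lambda>n. c *\<^sub>C t x n)"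
        by (simp add: t_def fun_eq_iff bounded_opsD(3) [OF bounded_ops_funpow [OF T]]
            linear_simps bounded_linear_scaleC)
      then show "t (c *\<^sub>C x) sums (c *\<^sub>C D x)"
        using bounded_linear.sums [OF bounded_linear_scaleC sums [OF x]] by simp
    qed (intro complex_vector.subspace_scale [OF sub] x)
  next
    have "norm (D x) \<le> norm x * (C * 2)" if "x \<in> N" for x
      using norm_sums_le [OF sums geo t_bound] that by (simp add: mult_ac)
    then show "\<exists>K. \<forall>x\<in>N. norm (D x) \<le> norm x * K"
      by blast
  qed
  moreover have "T (D x) + D x = x" if x: "x \<in> N" for x
  proof -
    have "bounded_linear T"
      using T bounded_ops_UNIV by blast
    \<comment> \<open>Applying \<open>T\<close> shifts the alternating series by one index and flips
      its sign, so -T (D x) is the sum without its first term x.\<close>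
    then have "(\<lambda>n. T (t x n)) sums T (D x)"
      by (rule bounded_linear.sums [OF _ sums [OF x]])
    moreover have "T (t x n) = - t x (Suc n)" for n
      using \<open>bounded_linear T\<close> by (simp add: t_def linear_simps)
    ultimately have "(\<lambda>n. - t x (Suc n)) sums T (D x)"
      by simp
    then have "(\<lambda>n. t x (Suc n)) sums (- T (D x))"
      using sums_minus by fastforce
    then have "t x sums (- T (D x) + t x 0)"
      by (simp add: sums_Suc_iff)
    then have "D x = - T (D x) + t x 0"
      by (rule D_eq [OF x])
    moreover have "t x 0 = x"
      by (simp add: t_def)
    ultimately have "D x = - T (D x) + x"
      by metis
    then show ?thesis
      by (metis add_minus_cancel)
  qed
  ultimately show ?thesis
    unfolding right_invertible_on_def by blast
qed

section \<open>Reducing subspaces and commuting projections\<close>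

text \<open>This is the projection onto \<open>N\<close> along \<open>M\<close>. Its
  characterisation by membership gives linearity by uniqueness of the decomposition, and closes the
  graph because \<open>N\<close> and \<open>M\<close> are closed.\<close>

lemma top_direct_sum_projection:
  fixes M N :: "'a::complex_banach set"
  assumes "top_direct_sum UNIV M N"
  obtains P where "projection P" "\<And>x y. P x = y \<longleftrightarrow> y \<in> N \<and> x - y \<in> M"
proof -
  have M: "complex_vector.subspace M" "closed M" and N: "complex_vector.subspace N" "closed N"
    and MN: "M \<inter> N = {0}" and UN: "UNIV = {x + y |x y. x \<in> M \<and> y \<in> N}"
    using assms by (auto simp: top_direct_sum_def closed_csubspace_def)
  have ex1: "\<exists>!y. y \<in> N \<and> x - y \<in> M" for x
  proof (rule ex_ex1I)
    have "x \<in> {x + y |x y. x \<in> M \<and> y \<in> N}"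
      using UN by blast
    then show "\<exists>y. y \<in> N \<and> x - y \<in> M"
      by force
    fix y z assume "y \<in> N \<and> x - y \<in> M" "z \<in> N \<and> x - z \<in> M"
    then have "y - z \<in> N" "(x - z) - (x - y) \<in> M"
      using complex_vector.subspace_diff M N by blast+
    then have "y - z \<in> M \<inter> N"
      by simp
    then show "y = z"
      unfolding MN by simp
  qed
  define P where "P x = (THE y. y \<in> N \<and> x - y \<in> M)" for x
  have PNM: "P x \<in> N \<and> x - P x \<in> M" for x
    unfolding P_def by (rule theI' [OF ex1])
  then have P: "P x = y \<longleftrightarrow> y \<in> N \<and> x - y \<in> M" for x y
    using ex1 [of x] by blast
  have add: "P (x + y) = P x + P y" for x y
  proof -
    have "(x - P x) + (y - P y) \<in> M" "P x + P y \<in> N"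
      using PNM complex_vector.subspace_add M N by blast+
    then show ?thesis
      by (simp add: P algebra_simps)
  qed
  have scale: "P (c *\<^sub>C x) = c *\<^sub>C P x" for c x
  proof -
    have "c *\<^sub>C (x - P x) \<in> M" "c *\<^sub>C P x \<in> N"
      using PNM complex_vector.subspace_scale M N by blast+
    then show ?thesis
      by (simp add: P linear_simps bounded_linear_scaleC)
  qed
  obtain K where "K \<ge> 0" "\<And>x. norm (P x) \<le> norm x * K"
  proof (rule closed_graph_bounded [of UNIV P])
    show "P (r *\<^sub>R x) = r *\<^sub>R P x" for r x
      using scale by (simp flip: scaleC_of_real)
    fix f x y
    assume f: "f \<longlonglongrightarrow> x" "(\<lambda>n. P (f n)) \<longlonglongrightarrow> y"
    have "y \<in> N"
      using closed_sequentially [OF N(2) _ f(2)] PNM by blast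
    moreover have "x - y \<in> M"
      using closed_sequentially [OF M(2) _ tendsto_diff [OF f]] PNM by blast
    ultimately show "P x = y"
      by (simp add: P)
  qed (use add in auto)
  then have "P \<in> bounded_ops UNIV"
    using add scale by (auto simp: bounded_ops_def)
  moreover have "P \<circ> P = P"
  proof
    show "(P \<circ> P) x = P x" for x
      using PNM complex_vector.subspace_0 [OF M(1)] by (simp add: P)
  qed
  ultimately show thesis
    using that [OF _ P] by (simp add: projection_def)
qed

text \<open>The range of an idempotent is its fixed-point set, so both summands are equalizers of
  continuous maps and hence closed; commutation makes them invariant.\<close>

lemma projection_reduces:
  fixes T :: "'a::complex_normed_vector \<Rightarrow> 'a"
  assumes P: "projection P" and TP: "T \<circ> P = P \<circ> T" and T: "T \<in> bounded_ops UNIV"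
  shows "reduces T {x. P x = 0} {x. P x = x}"
proof -
  have ops: "P \<in> bounded_ops UNIV" and PP: "P (P x) = P x" for x
    using P by (auto simp: projection_def fun_eq_iff)
  have lin: "bounded_linear P" and scale: "P (c *\<^sub>C x) = c *\<^sub>C P x" for c x
    using ops by (auto simp: bounded_ops_UNIV)
  have cont: "continuous_on UNIV P"
    using lin by (rule linear_continuous_on)
  have "closed {x. P x = 0}" "closed {x. P x = x}"
    using cont by (auto intro!: closed_Collect_eq continuous_intros)
  then have "closed_csubspace {x. P x = 0}" "closed_csubspace {x. P x = x}"
    by (auto simp: closed_csubspace_def complex_vector.subspace_def scale linear_simps lin)
  moreover have "x = (x - P x) + P x \<and> P (x - P x) = 0" for x
    by (simp add: linear_simps lin PP)
  then have "UNIV = {x + y |x y. x \<in> {x. P x = 0} \<and> y \<in> {x. P x = x}}"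
    using PP by (blast intro: sym)
  moreover have "P (T x) = T (P x)" for x
    using TP by (metis comp_apply)
  then have "T ` {x. P x = 0} \<subseteq> {x. P x = 0}" "T ` {x. P x = x} \<subseteq> {x. P x = x}"
    using bounded_ops_zero [OF T] by auto
  ultimately show ?thesis
    unfolding reduces_def top_direct_sum_def by (auto simp: linear_simps lin)
qed

text \<open>Powers of T P are T^n P for positive n, so on the range of P they agree with powers of
  T, and elsewhere they cost only the norm of P.\<close>

lemma quasi_nilpotent_comp_projection_iff:
  fixes T :: "'a::complex_normed_vector \<Rightarrow> 'a"
  assumes P: "projection P" and TP: "T \<circ> P = P \<circ> T" and T: "T \<in> bounded_ops UNIV"
  shows "quasi_nilpotent (\<lambda>x. T (P x)) \<longleftrightarrow> quasi_nilpotent_on {x. P x = x} T"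
proof -
  let ?N = "{x. P x = x}"
  have ops: "P \<in> bounded_ops UNIV" and PP: "P (P x) = P x" for x
    using P by (auto simp: projection_def fun_eq_iff)
  have comm: "P (T x) = T (P x)" for x
    using TP by (metis comp_apply)
  have red: "reduces T {x. P x = 0} ?N"
    by (rule projection_reduces [OF P TP T])
  then have zero: "0 \<in> ?N"
    by (auto simp: reduces_def top_direct_sum_def)
  have TN: "T \<in> bounded_ops ?N"
    using bounded_ops_restrict [OF T, of ?N] red by (simp add: reduces_def)
  have TPops: "(\<lambda>x. T (P x)) \<in> bounded_ops UNIV"
    by (rule bounded_ops_comp [OF T ops]) auto
  \<comment> \<open>Stated for successors only: at exponent 0 the left side is x and the right side
    is P x.\<close>
  have pow: "((\<lambda>x. T (P x)) ^^ Suc n) x = (T ^^ Suc n) (P x)" for n x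
  proof (induction n)
    case (Suc n)
    have "P ((T ^^ n) (P x)) = (T ^^ n) (P x)" for n
      by (induction n) (simp_all add: PP comm)
    then show ?case
      using Suc by (metis comp_apply funpow.simps(2))
  qed simp
  obtain K where K: "K \<ge> 0" "\<And>x. norm (P x) \<le> K * norm x"
    using bounded_ops_bound [OF ops] by auto
  show ?thesis
    unfolding quasi_nilpotent_on_iff [OF TN zero] quasi_nilpotent_on_iff [OF TPops UNIV_I]
  proof (intro iffI allI impI)
    fix \<epsilon> :: real
    assume \<epsilon>: "\<epsilon> > 0"
      and "\<forall>\<epsilon>>0. \<exists>C. \<forall>n. \<forall>x\<in>UNIV. norm (((\<lambda>x. T (P x)) ^^ n) x) \<le> C * \<epsilon> ^ n * norm x"
    then obtain C where C: "\<And>n x. norm (((\<lambda>x. T (P x)) ^^ n) x) \<le> C * \<epsilon> ^ n * norm x"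
      by blast
    have "((\<lambda>x. T (P x)) ^^ n) x = (T ^^ n) x" if "x \<in> ?N" for n x
      using that pow by (cases n) auto
    then show "\<exists>C. \<forall>n. \<forall>x\<in>?N. norm ((T ^^ n) x) \<le> C * \<epsilon> ^ n * norm x"
      using C by metis
  next
    fix \<epsilon> :: real
    assume \<epsilon>: "\<epsilon> > 0"
      and "\<forall>\<epsilon>>0. \<exists>C. \<forall>n. \<forall>x\<in>?N. norm ((T ^^ n) x) \<le> C * \<epsilon> ^ n * norm x"
    then obtain C where C: "\<And>n x. x \<in> ?N \<Longrightarrow> norm ((T ^^ n) x) \<le> C * \<epsilon> ^ n * norm x"
      by blast
    \<comment> \<open>The factor \<open>K\<close> bounds P, and the summand 1 takes care of exponent
      0, where the power is the identity.\<close>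
    have "norm (((\<lambda>x. T (P x)) ^^ n) x) \<le> (\<bar>C\<bar> * K + 1) * \<epsilon> ^ n * norm x" for n x
    proof (cases n)
      case 0
      then show ?thesis
        using K by (simp add: algebra_simps)
    next
      case (Suc m)
      have "norm (((\<lambda>x. T (P x)) ^^ n) x) \<le> C * \<epsilon> ^ n * norm (P x)"
        unfolding Suc pow using C [of "P x" "Suc m"] PP by simp
      also have "\<dots> \<le> \<bar>C\<bar> * \<epsilon> ^ n * (K * norm x)"
        using K \<epsilon> by (intro mult_mono) auto
      also have "\<dots> \<le> (\<bar>C\<bar> * K + 1) * \<epsilon> ^ n * norm x"
        using \<epsilon> by (simp add: algebra_simps)
      finally show ?thesis .
    qed
    then show "\<exists>C. \<forall>n. \<forall>x\<in>UNIV. norm (((\<lambda>x. T (P x)) ^^ n) x) \<le> C * \<epsilon> ^ n * norm x"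
      by blast
  qed
qed

text \<open>By invariance \<open>T\<close> sends the two components of x to the components of T x,
  which is commutation with the projection.\<close>

lemma reduces_projection:
  fixes T :: "'a::complex_banach \<Rightarrow> 'a"
  assumes red: "reduces T M N" and T: "T \<in> bounded_ops UNIV"
  obtains P where "projection P" "T \<circ> P = P \<circ> T" "M = {x. P x = 0}" "N = {x. P x = x}"
proof -
  have sum: "top_direct_sum UNIV M N" and inv: "T ` M \<subseteq> M" "T ` N \<subseteq> N"
    using red by (auto simp: reduces_def)
  have zero: "0 \<in> M" "0 \<in> N"
    using sum by (auto simp: top_direct_sum_def)
  obtain P where P: "projection P" "\<And>x y. P x = y \<longleftrightarrow> y \<in> N \<and> x - y \<in> M"
    using top_direct_sum_projection [OF sum] by metis
  have "P (T x) = T (P x)" for x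
  proof -
    have "P x \<in> N" "x - P x \<in> M"
      using P(2) [of x "P x"] by auto
    then have "T (P x) \<in> N" "T (x - P x) \<in> M"
      using inv by blast+
    moreover have "T (x - P x) = T x - T (P x)"
      using T by (simp add: bounded_ops_UNIV linear_simps)
    ultimately show ?thesis
      using P(2) by simp
  qed
  then have "T \<circ> P = P \<circ> T"
    by (simp add: fun_eq_iff)
  then show thesis
    using that P zero by simp
qed

section \<open>The analytical core\<close>

lemma zero_in_analytical_core:
  fixes T :: "'a::complex_normed_vector \<Rightarrow> 'a"
  assumes "T \<in> bounded_ops UNIV"
  shows "0 \<in> analytical_core T"
  unfolding analytical_core_def mem_Collect_eq using bounded_ops_zero [OF assms]
  by (intro exI [of _ "\<lambda>_. 0"] exI [of _ 1]) simp

text \<open>\<open>T\<close> only shifts backward orbits by one place. The point is the growth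
  bound, which is relative to the starting vector and must be renormalised after each shift. This
  gives surjectivity on the core.\<close>

lemma analytical_core_image:
  fixes T :: "'a::complex_normed_vector \<Rightarrow> 'a"
  assumes T: "T \<in> bounded_ops UNIV"
  shows "T ` analytical_core T = analytical_core T"
proof (intro equalityI subsetI)
  fix y assume "y \<in> T ` analytical_core T"
  then obtain u \<delta> where y: "y = T (u 0)" and \<delta>: "\<delta> > 0" and Tu: "\<And>n. T (u (Suc n)) = u n"
    and u: "\<And>n. n \<ge> 1 \<Longrightarrow> norm (u n) \<le> \<delta> ^ n * norm (u 0)"
    unfolding analytical_core_def by blast
  show "y \<in> analytical_core T"
  proof (cases "y = 0")
    case True
    then show ?thesis
      using zero_in_analytical_core [OF T] by simp
  next
    case False
    \<comment> \<open>Prepending y = T (u 0) replaces the reference norm of \<open>u 0\<close> by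
      that of y. The ratio \<open>c\<close> is absorbed by the extra factor that the index shift
      provides; this needs y nonzero.\<close>
    define c where "c = norm (u 0) / norm y"
    define \<eta> where "\<eta> = max \<delta> c"
    define v where "v n = (case n of 0 \<Rightarrow> y | Suc m \<Rightarrow> u m)" for n
    have u': "norm (u n) \<le> \<delta> ^ n * norm (u 0)" for n
      using u [of n] by (cases n) auto
    have \<eta>: "\<eta> > 0"
      using \<delta> by (simp add: \<eta>_def)
    have "norm (u n) \<le> \<eta> ^ Suc n * norm y" for n
    proof -
      have "norm (u n) \<le> \<delta> ^ n * (c * norm y)"
        using u' [of n] False by (simp add: c_def)
      also have "\<dots> \<le> \<eta> ^ n * (\<eta> * norm y)"
        using \<delta> \<eta> by (intro mult_mono power_mono) (auto simp: \<eta>_def c_def)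
      finally show ?thesis
        by (simp add: mult_ac)
    qed
    then have "norm (v n) \<le> \<eta> ^ n * norm y" if "n \<ge> 1" for n
      using that by (cases n) (auto simp: v_def)
    moreover have "T (v (Suc n)) = v n" for n
      by (cases n) (auto simp: v_def y Tu)
    moreover have "y = v 0"
      by (simp add: v_def)
    ultimately show ?thesis
      unfolding analytical_core_def using \<eta> by blast
  qed
next
  fix x assume "x \<in> analytical_core T"
  then obtain u \<delta> where x: "x = u 0" and \<delta>: "\<delta> > 0" and Tu: "\<And>n. T (u (Suc n)) = u n"
    and u: "\<And>n. n \<ge> 1 \<Longrightarrow> norm (u n) \<le> \<delta> ^ n * norm x"
    unfolding analytical_core_def by blast
  obtain K where K: "K \<ge> 0" "\<And>x. norm (T x) \<le> K * norm x"
    using bounded_ops_bound [OF T] by auto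
  \<comment> \<open>Dropping the first term costs the factor \<delta> K, since norm x is at most K
    norm (v 0). As c is at least 1 and n is positive, c^n absorbs this factor.\<close>
  define c where "c = max 1 (\<delta> * K)"
  define v where "v n = u (Suc n)" for n
  have "norm (v n) \<le> (\<delta> * c) ^ n * norm (v 0)" if "n \<ge> 1" for n
  proof -
    have "norm (v n) \<le> \<delta> ^ Suc n * norm x"
      using u [of "Suc n"] by (simp add: v_def)
    also have "\<dots> \<le> \<delta> ^ Suc n * (K * norm (v 0))"
      using K(2) [of "v 0"] \<delta> x by (intro mult_left_mono) (auto simp: v_def Tu)
    also have "\<dots> = \<delta> ^ n * (\<delta> * K) * norm (v 0)"
      by simp
    also have "\<dots> \<le> \<delta> ^ n * c ^ n * norm (v 0)"
    proof (intro mult_right_mono mult_left_mono)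
      have "c \<le> c ^ n"
        using that by (intro self_le_power) (auto simp: c_def)
      then show "\<delta> * K \<le> c ^ n"
        by (simp add: c_def)
    qed (use \<delta> in auto)
    finally show ?thesis
      by (simp add: power_mult_distrib)
  qed
  moreover have "T (v (Suc n)) = v n" for n
    by (simp add: v_def Tu)
  moreover have "\<delta> * c > 0"
    using \<delta> by (simp add: c_def less_max_iff_disj)
  ultimately have "v 0 \<in> analytical_core T"
    unfolding analytical_core_def by blast
  then show "x \<in> T ` analytical_core T"
    using Tu [of 0] x by (force simp: v_def)
qed

lemma analytical_core_eq_reducing:
  fixes T :: "'a::complex_banach \<Rightarrow> 'a"
  assumes T: "T \<in> bounded_ops UNIV" and red: "reduces T M N"
    and ri: "right_invertible_on M T" and qn: "quasi_nilpotent_on N T"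
  shows "analytical_core T = M"
proof (intro equalityI subsetI)
  fix x assume x: "x \<in> M"
  obtain B where B: "B \<in> bounded_ops M" and TB: "\<And>x. x \<in> M \<Longrightarrow> T (B x) = x"
    using ri unfolding right_invertible_on_def by blast
  obtain K where K: "K \<ge> 0" "\<And>x. x \<in> M \<Longrightarrow> norm (B x) \<le> K * norm x"
    using bounded_ops_bound [OF B] by metis
  \<comment> \<open>Iterating the right inverse produces a backward orbit inside \<open>M\<close>;
    the rate K + 1 is positive even if \<open>K\<close> is 0.\<close>
  define u where "u n = (B ^^ n) x" for n
  have u: "u n \<in> M" for n
    unfolding u_def by (rule bounded_opsD(1) [OF bounded_ops_funpow [OF B] x])
  have "norm (u n) \<le> (K + 1) ^ n * norm x" for n
  proof (induction n)
    case (Suc n)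
    have "norm (u (Suc n)) \<le> K * norm (u n)"
      using K(2) [OF u] by (simp add: u_def)
    also have "\<dots> \<le> (K + 1) * ((K + 1) ^ n * norm x)"
      using Suc K by (intro mult_mono) auto
    finally show ?case
      by (simp add: mult_ac)
  qed (simp add: u_def)
  moreover have "T (u (Suc n)) = u n" for n
    using TB [OF u] by (simp add: u_def)
  moreover have "x = u 0" "K + 1 > 0"
    using K by (auto simp: u_def)
  ultimately show "x \<in> analytical_core T"
    unfolding analytical_core_def by blast
next
  fix x assume "x \<in> analytical_core T"
  then obtain u \<delta> where x: "x = u 0" and \<delta>: "\<delta> > 0" and Tu: "\<And>n. T (u (Suc n)) = u n"
    and u: "\<And>n. n \<ge> 1 \<Longrightarrow> norm (u n) \<le> \<delta> ^ n * norm x"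
    unfolding analytical_core_def by blast
  obtain P where P: "projection P" and TP: "T \<circ> P = P \<circ> T"
    and M: "M = {x. P x = 0}" and N: "N = {x. P x = x}"
    using reduces_projection [OF red T] by metis
  have ops: "P \<in> bounded_ops UNIV" and PP: "P (P x) = P x" for x
    using P by (auto simp: projection_def fun_eq_iff)
  have comm: "T (P x) = P (T x)" for x
    using TP by (metis comp_apply)
  obtain L where L: "L \<ge> 0" "\<And>x. norm (P x) \<le> L * norm x"
    using bounded_ops_bound [OF ops] by auto
  have zero: "0 \<in> N"
    using red by (auto simp: reduces_def top_direct_sum_def)
  have TN: "T \<in> bounded_ops N"
    using bounded_ops_restrict [OF T, of N] red by (simp add: reduces_def)
  \<comment> \<open>Chosen so that the decay of T^n on \<open>N\<close> beats the growth \<delta>^n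
    of the orbit, leaving the factor 2^(-n).\<close>
  define \<epsilon> where "\<epsilon> = 1 / (2 * \<delta>)"
  have \<epsilon>: "\<epsilon> > 0"
    using \<delta> by (simp add: \<epsilon>_def)
  then obtain C where C: "\<And>n x. x \<in> N \<Longrightarrow> norm ((T ^^ n) x) \<le> C * \<epsilon> ^ n * norm x"
    using qn unfolding quasi_nilpotent_on_iff [OF TN zero] by blast
  \<comment> \<open>Since P commutes with \<open>T\<close>, the vectors P (u n) form a backward
    orbit of P x inside \<open>N\<close>.\<close>
  have pow: "(T ^^ n) (P (u n)) = P x" for n
    by (induction n) (simp_all add: x comm Tu funpow_swap1 del: funpow.simps(2) add: funpow_Suc_right)
  have le: "norm (P x) \<le> \<bar>C\<bar> * L * norm x * (1/2) ^ n" if "n \<ge> 1" for n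
  proof -
    have "norm (P x) \<le> C * \<epsilon> ^ n * norm (P (u n))"
      using C [of "P (u n)" n] by (simp add: pow N PP)
    also have "\<dots> \<le> \<bar>C\<bar> * \<epsilon> ^ n * (L * (\<delta> ^ n * norm x))"
      using \<epsilon> L u [OF that] by (intro mult_mono order_trans [OF L(2)] mult_left_mono) auto
    also have "\<dots> = \<bar>C\<bar> * L * norm x * (\<epsilon> * \<delta>) ^ n"
      by (simp add: power_mult_distrib)
    also have "\<epsilon> * \<delta> = 1/2"
      using \<delta> by (simp add: \<epsilon>_def)
    finally show ?thesis .
  qed
  have "(\<lambda>n. \<bar>C\<bar> * L * norm x * (1/2) ^ n) \<longlonglongrightarrow> 0"
    by (intro tendsto_mult_right_zero LIMSEQ_power_zero) simp
  then have "norm (P x) \<le> 0"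
    by (rule LIMSEQ_le_const) (use le in blast)
  then show "x \<in> M"
    by (simp add: M)
qed

section \<open>Conditions expressed through reducing subspaces\<close>

lemma pseudo_inverse_imp_reducing:
  fixes T :: "'a::complex_banach \<Rightarrow> 'a"
  assumes T: "T \<in> bounded_ops UNIV" and S: "S \<in> bounded_ops UNIV"
    and eqs: "T \<circ> S \<circ> T = T \<circ> T \<circ> S" "T \<circ> S \<circ> S = S"
    and qn: "quasi_nilpotent (\<lambda>x. (T \<circ> S \<circ> T) x - T x)"
  shows "\<exists>M N. reduces T M N \<and> right_invertible_on M T \<and> quasi_nilpotent_on N T"
proof -
  have TST: "T (S (T x)) = T (T (S x))" and TSS: "T (S (S x)) = S x" for x
    using eqs by (metis comp_apply)+
  define P where "P x = x - T (S x)" for x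
  have lin: "bounded_linear T" "bounded_linear S"
    using T S bounded_ops_UNIV by blast+
  have "(\<lambda>x. T (S x)) \<in> bounded_ops UNIV"
    by (rule bounded_ops_comp [OF T S]) auto
  then have ops: "P \<in> bounded_ops UNIV"
    unfolding P_def by (intro bounded_ops_diff bounded_ops_id) auto
  \<comment> \<open>Idempotence of T S: T S T S = T T S S = T S, by the two equations in
    turn.\<close>
  have P: "projection P"
    using ops by (simp add: projection_def fun_eq_iff P_def linear_simps lin TST TSS)
  have TP: "T \<circ> P = P \<circ> T"
    by (simp add: fun_eq_iff P_def linear_simps lin TST)
  have TPlin: "T (P (- x)) = - T (P x)" for x
    by (simp add: P_def linear_simps lin)
  have "(\<lambda>x. (T \<circ> S \<circ> T) x - T x) = (\<lambda>x. - T (P x))"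
    by (simp add: fun_eq_iff P_def linear_simps lin TST)
  then have "quasi_nilpotent (\<lambda>x. T (P x))"
    using qn quasi_nilpotent_on_uminus [of "\<lambda>x. T (P x)", OF TPlin] by simp
  then have "quasi_nilpotent_on {x. P x = x} T"
    using quasi_nilpotent_comp_projection_iff [OF P TP T] by blast
  \<comment> \<open>T S S = S says P S = 0, so \<open>S\<close> preserves the kernel of P, on which
    T S is the identity.\<close>
  moreover have "right_invertible_on {x. P x = 0} T"
    unfolding right_invertible_on_def
  proof (intro bexI ballI)
    show "S \<in> bounded_ops {x. P x = 0}"
      by (rule bounded_ops_restrict [OF S]) (auto simp: P_def TSS)
  qed (simp add: P_def)
  ultimately show ?thesis
    using projection_reduces [OF P TP T] by blast
qed

lemma reducing_imp_pseudo_inverse: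
  fixes T :: "'a::complex_banach \<Rightarrow> 'a"
  assumes T: "T \<in> bounded_ops UNIV" and red: "reduces T M N"
    and ri: "right_invertible_on M T" and qn: "quasi_nilpotent_on N T"
  shows "\<exists>S\<in>bounded_ops UNIV. T \<circ> S \<circ> T = T \<circ> T \<circ> S \<and> T \<circ> S \<circ> S = S
      \<and> quasi_nilpotent (\<lambda>x. (T \<circ> S \<circ> T) x - T x)"
proof -
  obtain B where B: "B \<in> bounded_ops M" and TB: "\<And>x. x \<in> M \<Longrightarrow> T (B x) = x"
    using ri unfolding right_invertible_on_def by blast
  obtain P where P: "projection P" and TP: "T \<circ> P = P \<circ> T"
    and M: "M = {x. P x = 0}" and N: "N = {x. P x = x}"
    using reduces_projection [OF red T] by metis
  have ops: "P \<in> bounded_ops UNIV" and PP: "P (P x) = P x" for x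
    using P by (auto simp: projection_def fun_eq_iff)
  have comm: "P (T x) = T (P x)" for x
    using TP by (metis comp_apply)
  have lin: "bounded_linear T" "bounded_linear P"
    using T ops bounded_ops_UNIV by blast+
  have QM: "x - P x \<in> M" for x
    by (simp add: M linear_simps lin PP)
  \<comment> \<open>\<open>S\<close> extends \<open>B\<close> by zero on \<open>N\<close>. Thus T S
    = I - P and P S = 0, from which both equations and T S T - T = -T P follow.\<close>
  define S where "S x = B (x - P x)" for x
  have S: "S \<in> bounded_ops UNIV"
    unfolding S_def using QM
    by (intro bounded_ops_comp [OF B] bounded_ops_diff bounded_ops_id ops) auto
  have TS: "T (S x) = x - P x" for x
    unfolding S_def by (rule TB [OF QM])
  have PS: "P (S x) = 0" for x
    using bounded_opsD(1) [OF B QM] by (simp add: S_def M)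
  have "(\<lambda>x. (T \<circ> S \<circ> T) x - T x) = (\<lambda>x. - T (P x))"
    by (simp add: fun_eq_iff TS comm)
  moreover have "quasi_nilpotent (\<lambda>x. - T (P x))"
    using qn quasi_nilpotent_comp_projection_iff [OF P TP T]
      quasi_nilpotent_on_uminus [of "\<lambda>x. T (P x)"]
    by (simp add: N linear_simps lin)
  ultimately show ?thesis
    using S by (intro bexI [of _ S]) (auto simp: fun_eq_iff TS PS comm linear_simps lin)
qed

text \<open>If R is a right inverse of T + P, its compression (I - P) R is a right inverse of
  \<open>T\<close> on the kernel of P.\<close>

lemma projection_imp_reducing:
  fixes T :: "'a::complex_banach \<Rightarrow> 'a"
  assumes T: "T \<in> bounded_ops UNIV" and P: "projection P" and TP: "T \<circ> P = P \<circ> T"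
    and ri: "right_invertible (\<lambda>x. T x + P x)" and qn: "quasi_nilpotent (T \<circ> P)"
  shows "\<exists>M N. reduces T M N \<and> right_invertible_on M T \<and> quasi_nilpotent_on N T"
proof -
  have ops: "P \<in> bounded_ops UNIV" and PP: "P (P x) = P x" for x
    using P by (auto simp: projection_def fun_eq_iff)
  have comm: "P (T x) = T (P x)" for x
    using TP by (metis comp_apply)
  have lin: "bounded_linear T" "bounded_linear P"
    using T ops bounded_ops_UNIV by blast+
  obtain R where R: "R \<in> bounded_ops UNIV" and TR: "\<And>x. T (R x) + P (R x) = x"
    using ri unfolding right_invertible_on_def by blast
  have "(\<lambda>x. R x - P (R x)) \<in> bounded_ops UNIV"
    by (intro bounded_ops_diff R bounded_ops_comp [OF ops R]) auto
  then have "(\<lambda>x. R x - P (R x)) \<in> bounded_ops {x. P x = 0}"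
    by (rule bounded_ops_restrict) (auto simp: linear_simps lin PP)
  moreover have "T (R x - P (R x)) = x" if "P x = 0" for x
  proof -
    \<comment> \<open>Applying P to (T + P) R x = x shows T P R x = -P R x, so removing the
      component P R x replaces the term P R x exactly.\<close>
    have "P (T (R x) + P (R x)) = 0"
      using TR that by simp
    then have "T (P (R x)) + P (R x) = 0"
      by (simp add: linear_simps lin comm PP)
    then have "T (P (R x)) = - P (R x)"
      by (simp add: eq_neg_iff_add_eq_0)
    then show ?thesis
      using TR [of x] by (simp add: linear_simps lin)
  qed
  ultimately have "right_invertible_on {x. P x = 0} T"
    unfolding right_invertible_on_def by (intro bexI [of _ "\<lambda>x. R x - P (R x)"] ballI) auto
  moreover have "quasi_nilpotent_on {x. P x = x} T"
    using qn quasi_nilpotent_comp_projection_iff [OF P TP T] by (simp add: comp_def)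
  ultimately show ?thesis
    using projection_reduces [OF P TP T] by blast
qed

lemma reducing_imp_projection:
  fixes T :: "'a::complex_banach \<Rightarrow> 'a"
  assumes T: "T \<in> bounded_ops UNIV" and red: "reduces T M N"
    and ri: "right_invertible_on M T" and qn: "quasi_nilpotent_on N T"
  shows "\<exists>P. projection P \<and> T \<circ> P = P \<circ> T
      \<and> right_invertible (\<lambda>x. T x + P x) \<and> quasi_nilpotent (T \<circ> P)"
proof -
  obtain B where B: "B \<in> bounded_ops M" and TB: "\<And>x. x \<in> M \<Longrightarrow> T (B x) = x"
    using ri unfolding right_invertible_on_def by blast
  have "closed_csubspace N" "T ` N \<subseteq> N"
    using red by (auto simp: reduces_def top_direct_sum_def)
  then obtain D where D: "D \<in> bounded_ops N" and TD: "\<And>x. x \<in> N \<Longrightarrow> T (D x) + D x = x"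
    using quasi_nilpotent_on_imp_right_invertible_add_id [OF T _ _ qn]
    unfolding right_invertible_on_def by blast
  obtain P where P: "projection P" and TP: "T \<circ> P = P \<circ> T"
    and M: "M = {x. P x = 0}" and N: "N = {x. P x = x}"
    using reduces_projection [OF red T] by metis
  have ops: "P \<in> bounded_ops UNIV" and PP: "P (P x) = P x" for x
    using P by (auto simp: projection_def fun_eq_iff)
  have lin: "bounded_linear T" "bounded_linear P"
    using T ops bounded_ops_UNIV by blast+
  have QM: "x - P x \<in> M" and PN: "P x \<in> N" for x
    by (simp_all add: M N linear_simps lin PP)
  \<comment> \<open>Blockwise inverse: \<open>B\<close> serves the kernel of P and \<open>D\<close>
    its range. Each output stays in its own summand, so P kills the first and fixes the
    second.\<close>
  define R where "R x = B (x - P x) + D (P x)" for x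
  have "R \<in> bounded_ops UNIV"
    unfolding R_def using QM PN
    by (intro bounded_ops_add bounded_ops_comp [OF B] bounded_ops_comp [OF D]
        bounded_ops_diff bounded_ops_id ops) auto
  moreover have "T (R x) + P (R x) = x" for x
  proof -
    have "P (B (x - P x)) = 0" "P (D (P x)) = D (P x)"
      using bounded_opsD(1) [OF B QM] bounded_opsD(1) [OF D PN] by (simp_all add: M N)
    then have "T (R x) + P (R x) = T (B (x - P x)) + (T (D (P x)) + D (P x))"
      by (simp add: R_def linear_simps lin)
    then show ?thesis
      by (simp add: TB [OF QM] TD [OF PN])
  qed
  ultimately have "right_invertible (\<lambda>x. T x + P x)"
    unfolding right_invertible_on_def by blast
  moreover have "quasi_nilpotent (T \<circ> P)"
    using qn quasi_nilpotent_comp_projection_iff [OF P TP T] by (simp add: N comp_def)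
  ultimately show ?thesis
    using P TP by blast
qed

section \<open>The condition on the null space\<close>

text \<open>\<open>A\<close> is controlled only on \<open>M\<close>, so closedness is shown by
  sequences: for a limit l of kernel vectors f n, A l = A (l - f n), which the bound on
  \<open>M\<close> forces to 0.\<close>

lemma closed_csubspace_kernel_on:
  fixes A :: "'a::complex_normed_vector \<Rightarrow> 'a"
  assumes A: "A \<in> bounded_ops M" and M: "closed_csubspace M"
  shows "closed_csubspace {x \<in> M. A x = 0}"
proof -
  have sub: "complex_vector.subspace M" and cl: "closed M"
    using M by (auto simp: closed_csubspace_def)
  obtain K where K: "K \<ge> 0" "\<And>x. x \<in> M \<Longrightarrow> norm (A x) \<le> K * norm x"
    using bounded_ops_bound [OF A] by metis
  have "complex_vector.subspace {x \<in> M. A x = 0}"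
    using complex_vector.subspace_0 [OF sub] complex_vector.subspace_add [OF sub]
      complex_vector.subspace_scale [OF sub]
    by (auto simp: complex_vector.subspace_def bounded_opsD [OF A] bounded_ops_zero [OF A])
  moreover have "l \<in> {x \<in> M. A x = 0}"
    if f: "\<And>n. f n \<in> {x \<in> M. A x = 0}" and lim: "f \<longlonglongrightarrow> l" for f l
  proof -
    have l: "l \<in> M"
      using closed_sequentially [OF cl _ lim] f by blast
    have diff: "l - f n \<in> M" for n
      using f l complex_vector.subspace_diff [OF sub] by blast
    have "A l = A (l - f n)" for n
      using bounded_opsD(2) [OF A diff, of "f n" n] f [of n] by simp
    then have "norm (A l) \<le> K * norm (l - f n)" for n
      using K(2) [OF diff] by metis
    moreover have "(\<lambda>n. K * norm (l - f n)) \<longlonglongrightarrow> 0"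
      using tendsto_mult_right_zero [OF tendsto_norm_zero [OF LIM_zero [OF lim]]]
      by (simp add: norm_minus_commute)
    ultimately have "norm (A l) \<le> 0"
      using LIMSEQ_le_const by blast
    then show ?thesis
      using l by simp
  qed
  ultimately show ?thesis
    unfolding closed_csubspace_def closed_sequential_limits by blast
qed

text \<open>For a right inverse B, the operator B T is idempotent on \<open>M\<close> with the same
  kernel as \<open>T\<close> there; its fixed-point set is the complement.\<close>

lemma right_invertible_on_imp_null_space_complemented:
  fixes T :: "'a::complex_normed_vector \<Rightarrow> 'a"
  assumes T: "T \<in> bounded_ops M" and M: "closed_csubspace M" and ri: "right_invertible_on M T"
  shows "top_complemented_in M (null_space T \<inter> M)"
proof -
  obtain B where B: "B \<in> bounded_ops M" and TB: "\<And>x. x \<in> M \<Longrightarrow> T (B x) = x"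
    using ri unfolding right_invertible_on_def by blast
  have sub: "complex_vector.subspace M"
    using M by (simp add: closed_csubspace_def)
  have zero: "0 \<in> M" "T 0 = 0" "B 0 = 0"
    using complex_vector.subspace_0 [OF sub] bounded_ops_zero [OF T] bounded_ops_zero [OF B] by auto
  have T_diff: "T (x - y) = T x - T y" if "x \<in> M" "y \<in> M" for x y
    using bounded_opsD(2) [OF T, of "x - y" y] that complex_vector.subspace_diff [OF sub] by simp
  have BT: "(\<lambda>x. B (T x)) \<in> bounded_ops M"
    using bounded_opsD(1) [OF T] by (intro bounded_ops_comp [OF B T]) auto
  let ?K = "null_space T \<inter> M" and ?L = "{x \<in> M. B (T x) = x}"
  have "?K = {x \<in> M. T x = 0}"
    by (auto simp: null_space_def)
  then have "closed_csubspace ?K"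
    using closed_csubspace_kernel_on [OF T M] by simp
  \<comment> \<open>The fixed-point set is the kernel of B T - I on \<open>M\<close>.\<close>
  moreover have "closed_csubspace ?L"
    using closed_csubspace_kernel_on [OF bounded_ops_diff [OF sub BT bounded_ops_id] M] by simp
  moreover have "?K \<inter> ?L = {0}"
    using zero by (auto simp: null_space_def)
  moreover have "M = {x + y |x y. x \<in> ?K \<and> y \<in> ?L}"
  proof (intro equalityI subsetI)
    fix x assume x: "x \<in> M"
    have BTx: "B (T x) \<in> M"
      by (rule bounded_opsD(1) [OF BT x])
    then have "x - B (T x) \<in> ?K"
      using x complex_vector.subspace_diff [OF sub] bounded_opsD(1) [OF T x]
      by (simp add: null_space_def T_diff TB)
    moreover have "B (T x) \<in> ?L"
      using BTx bounded_opsD(1) [OF T x] by (simp add: TB)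
    ultimately have "(x - B (T x)) + B (T x) \<in> {x + y |x y. x \<in> ?K \<and> y \<in> ?L}"
      by blast
    then show "x \<in> {x + y |x y. x \<in> ?K \<and> y \<in> ?L}"
      by simp
  qed (use complex_vector.subspace_add [OF sub] in blast)
  ultimately have "top_direct_sum M ?K ?L"
    by (simp only: top_direct_sum_def simp_thms)
  then show ?thesis
    unfolding top_complemented_in_def by blast
qed

text \<open>\<open>T\<close> maps a complement of its kernel in \<open>M\<close> bijectively onto
  \<open>M\<close>; the inverse of this bijection is the right inverse, bounded by the closed graph
  theorem.\<close>

lemma null_space_complemented_imp_right_invertible_on:
  fixes T :: "'a::complex_banach \<Rightarrow> 'a"
  assumes T: "T \<in> bounded_ops UNIV" and M: "closed_csubspace M" and surj: "T ` M = M"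
    and compl: "top_complemented_in M (null_space T \<inter> M)"
  shows "right_invertible_on M T"
proof -
  obtain L where "top_direct_sum M (null_space T \<inter> M) L"
    using compl unfolding top_complemented_in_def by blast
  then have L: "complex_vector.subspace L" "closed L" and KL: "(null_space T \<inter> M) \<inter> L = {0}"
    and decomp: "M = {x + y |x y. x \<in> null_space T \<inter> M \<and> y \<in> L}"
    by (auto simp: top_direct_sum_def closed_csubspace_def)
  have sub: "complex_vector.subspace M" and cl: "closed M"
    using M by (auto simp: closed_csubspace_def)
  have lin: "bounded_linear T"
    using T bounded_ops_UNIV by blast
  have LM: "L \<subseteq> M"
  proof
    fix y assume "y \<in> L"
    moreover have "0 \<in> null_space T \<inter> M"
      using KL by blast
    ultimately have "0 + y \<in> {x + y |x y. x \<in> null_space T \<inter> M \<and> y \<in> L}"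
      by blast
    then show "y \<in> M"
      by (subst decomp) simp
  qed
  have ex1: "\<exists>!x. x \<in> L \<and> T x = y" if "y \<in> M" for y
  proof (rule ex_ex1I)
    have "y \<in> T ` M"
      by (simp add: surj that)
    then obtain z where z: "z \<in> M" "T z = y"
      by blast
    have "z \<in> {x + y |x y. x \<in> null_space T \<inter> M \<and> y \<in> L}"
      using z(1) by (subst (asm) decomp)
    then obtain a b where "z = a + b" "a \<in> null_space T" "b \<in> L"
      by blast
    then show "\<exists>x. x \<in> L \<and> T x = y"
      using z(2) by (intro exI [of _ b]) (simp add: null_space_def linear_simps lin)
    fix x x' assume x: "x \<in> L \<and> T x = y" "x' \<in> L \<and> T x' = y"
    then have "x - x' \<in> L"
      using complex_vector.subspace_diff [OF L(1)] by blast
    moreover have "T (x - x') = 0"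
      using x by (simp add: linear_simps lin)
    ultimately have "x - x' \<in> (null_space T \<inter> M) \<inter> L"
      using LM by (auto simp: null_space_def)
    then show "x = x'"
      unfolding KL by simp
  qed
  define S where "S y = (THE x. x \<in> L \<and> T x = y)" for y
  have S: "S y \<in> L" "T (S y) = y" if "y \<in> M" for y
    using theI' [OF ex1 [OF that]] by (auto simp: S_def)
  \<comment> \<open>Uniqueness of preimages in \<open>L\<close> reduces linearity and closedness of
    the graph to properties of \<open>T\<close>.\<close>
  have S_eq: "S y = x" if "x \<in> L" "T x = y" for x y
  proof -
    have "T x \<in> T ` M"
      using that LM by blast
    then have "y \<in> M"
      by (simp add: surj that)
    then show ?thesis
      unfolding S_def using that by (intro the1_equality ex1) auto
  qed
  have add: "S (x + y) = S x + S y" if "x \<in> M" "y \<in> M" for x y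
    by (rule S_eq) (use S that complex_vector.subspace_add [OF L(1)] in \<open>auto simp: linear_simps lin\<close>)
  have scale: "S (c *\<^sub>C x) = c *\<^sub>C S x" if "x \<in> M" for c x
    by (rule S_eq) (use S that complex_vector.subspace_scale [OF L(1)] bounded_opsD(3) [OF T] in auto)
  obtain K where "K \<ge> 0" "\<And>x. x \<in> M \<Longrightarrow> norm (S x) \<le> norm x * K"
  proof (rule closed_graph_bounded [OF csubspace_imp_subspace [OF sub] cl, of S])
    show "S (r *\<^sub>R x) = r *\<^sub>R S x" if "x \<in> M" for r x
      using scale [OF that, of "of_real r"] by (simp add: scaleC_of_real)
    fix f x y
    assume f: "\<And>n. f n \<in> M" "f \<longlonglongrightarrow> x" "(\<lambda>n. S (f n)) \<longlonglongrightarrow> y"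
    show "S x = y"
    proof (rule S_eq)
      show "y \<in> L"
        using closed_sequentially [OF L(2) _ f(3)] S(1) [OF f(1)] by blast
      have "(\<lambda>n. T (S (f n))) \<longlonglongrightarrow> T y"
        by (rule bounded_linear.tendsto [OF lin f(3)])
      then have "f \<longlonglongrightarrow> T y"
        by (simp add: S(2) [OF f(1)])
      then show "T y = x"
        using f(2) LIMSEQ_unique by blast
    qed
  qed (use add in auto)
  then have "S \<in> bounded_ops M"
    unfolding bounded_ops_def using add scale S(1) LM by blast
  then show ?thesis
    unfolding right_invertible_on_def using S(2) by blast
qed

lemma quasi_nilpotent_on_iff_subset_quasi_nilpotent_part:
  fixes T :: "'a::complex_banach \<Rightarrow> 'a"
  assumes T: "T \<in> bounded_ops UNIV" and N: "closed_csubspace N" and inv: "T ` N \<subseteq> N"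
  shows "quasi_nilpotent_on N T \<longleftrightarrow> N \<subseteq> quasi_nilpotent_part T"
proof -
  have sub: "subspace N" "closed N"
    using N closed_csubspace_imp_subspace by (auto simp: closed_csubspace_def)
  have TN: "T \<in> bounded_ops N"
    using bounded_ops_restrict [OF T _ inv] by simp
  have "(\<exists>C. \<forall>n. \<forall>x\<in>N. norm ((T ^^ n) x) \<le> C * \<epsilon> ^ n * norm x)
    \<longleftrightarrow> (\<forall>x\<in>N. \<exists>C. \<forall>n. norm ((T ^^ n) x) \<le> C * \<epsilon> ^ n)" if \<epsilon>: "\<epsilon> > 0" for \<epsilon>
  proof
    assume "\<exists>C. \<forall>n. \<forall>x\<in>N. norm ((T ^^ n) x) \<le> C * \<epsilon> ^ n * norm x"
    then obtain C where "\<And>n x. x \<in> N \<Longrightarrow> norm ((T ^^ n) x) \<le> C * \<epsilon> ^ n * norm x"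
      by blast
    then have "norm ((T ^^ n) x) \<le> (C * norm x) * \<epsilon> ^ n" if "x \<in> N" for n x
      using that by (simp add: mult_ac)
    then show "\<forall>x\<in>N. \<exists>C. \<forall>n. norm ((T ^^ n) x) \<le> C * \<epsilon> ^ n"
      by blast
  next
    assume pointwise: "\<forall>x\<in>N. \<exists>C. \<forall>n. norm ((T ^^ n) x) \<le> C * \<epsilon> ^ n"
    \<comment> \<open>The rescaled powers T^n / \<epsilon>^n are pointwise bounded on
      \<open>N\<close>; uniform boundedness makes the constant independent of x.\<close>
    obtain K where K: "\<And>x n. x \<in> N \<Longrightarrow> norm ((1 / \<epsilon> ^ n) *\<^sub>R (T ^^ n) x) \<le> norm x * K"
    proof (rule uniform_boundedness_on [OF sub, of "\<lambda>n x. (1 / \<epsilon> ^ n) *\<^sub>R (T ^^ n) x"])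
      show "bounded_linear (\<lambda>x. (1 / \<epsilon> ^ n) *\<^sub>R (T ^^ n) x)" for n
        by (intro bounded_linear_const_scaleR bounded_linear_funpow T)
      show "\<exists>C. \<forall>n. norm ((1 / \<epsilon> ^ n) *\<^sub>R (T ^^ n) x) \<le> C" if "x \<in> N" for x
        using pointwise that \<epsilon> by (fastforce simp: field_simps)
    qed blast
    have "norm ((T ^^ n) x) \<le> K * \<epsilon> ^ n * norm x" if "x \<in> N" for n x
      using K [OF that, of n] \<epsilon> by (simp add: field_simps)
    then show "\<exists>C. \<forall>n. \<forall>x\<in>N. norm ((T ^^ n) x) \<le> C * \<epsilon> ^ n * norm x"
      by blast
  qed
  then show ?thesis
    unfolding quasi_nilpotent_on_iff [OF TN subspace_0 [OF sub(1)]] quasi_nilpotent_part_def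
    by (auto simp: root_tendsto_0_iff)
qed

section \<open>Equivalence of the five conditions\<close>

lemma all_equivalent5I:
  assumes "a \<longleftrightarrow> e" "b \<longleftrightarrow> e" "c \<longleftrightarrow> d" "d \<longleftrightarrow> e"
  shows "all_equivalent [a, b, c, d, e]"
  using assms by (simp add: all_equivalent_def)

theorem theorem3p7:
  fixes T :: "'a::complex_banach \<Rightarrow> 'a"
  assumes "T \<in> bounded_ops UNIV"
  shows "all_equivalent
   [\<exists>S\<in>bounded_ops UNIV. T \<circ> S \<circ> T = T \<circ> T \<circ> S \<and> T \<circ> S \<circ> S = S
      \<and> quasi_nilpotent (\<lambda>x. (T \<circ> S \<circ> T) x - T x),
    \<exists>P. projection P \<and> T \<circ> P = P \<circ> T
      \<and> right_invertible (\<lambda>x. T x + P x) \<and> quasi_nilpotent (T \<circ> P),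
    (\<exists>N. top_direct_sum UNIV (analytical_core T) N
        \<and> T ` N \<subseteq> N \<and> N \<subseteq> quasi_nilpotent_part T)
      \<and> top_complemented_in (analytical_core T) (null_space T \<inter> analytical_core T),
    \<exists>N. reduces T (analytical_core T) N
      \<and> right_invertible_on (analytical_core T) T \<and> quasi_nilpotent_on N T,
    \<exists>M N. reduces T M N \<and> right_invertible_on M T \<and> quasi_nilpotent_on N T]"
    (is "all_equivalent [?i, ?ii, ?iii, ?iv, ?v]")
proof (rule all_equivalent5I)
  show "?i \<longleftrightarrow> ?v"
    by (blast intro: pseudo_inverse_imp_reducing [OF assms]
        dest: reducing_imp_pseudo_inverse [OF assms])
  show "?ii \<longleftrightarrow> ?v"
    by (blast intro: projection_imp_reducing [OF assms] dest: reducing_imp_projection [OF assms])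
  show "?iv \<longleftrightarrow> ?v"
  proof
    assume ?v
    then obtain M N where MN: "reduces T M N" "right_invertible_on M T" "quasi_nilpotent_on N T"
      by blast
    \<comment> \<open>The first summand of every such reducing pair is forced, so the pair itself
      witnesses the fourth condition.\<close>
    then have "analytical_core T = M"
      by (rule analytical_core_eq_reducing [OF assms])
    then show ?iv
      using MN by (intro exI [of _ N]) simp
  qed blast
  show "?iii \<longleftrightarrow> ?iv"
  proof -
    let ?K = "analytical_core T"
    have image: "T ` ?K = ?K"
      by (rule analytical_core_image [OF assms])
    have TK: "T \<in> bounded_ops ?K"
      by (rule bounded_ops_restrict [OF assms]) (simp_all add: image)
    \<comment> \<open>For fixed \<open>N\<close> the two conditions match conjunct by conjunct. The
      complementation conjunct does not mention \<open>N\<close>, so it may be placed under the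
      quantifier.\<close>
    have "top_direct_sum UNIV ?K N \<and> T ` N \<subseteq> N \<and> N \<subseteq> quasi_nilpotent_part T
          \<and> top_complemented_in ?K (null_space T \<inter> ?K)
      \<longleftrightarrow> reduces T ?K N \<and> right_invertible_on ?K T \<and> quasi_nilpotent_on N T" for N
    \<comment> \<open>Closedness of the core is available only through the direct sum; without the
      sum and invariance both sides are false.\<close>
    proof (cases "top_direct_sum UNIV ?K N \<and> T ` N \<subseteq> N")
      case True
      then have cl: "closed_csubspace ?K" "closed_csubspace N" and inv: "T ` N \<subseteq> N"
        by (auto simp: top_direct_sum_def)
      have "top_complemented_in ?K (null_space T \<inter> ?K) \<longleftrightarrow> right_invertible_on ?K T"
        using right_invertible_on_imp_null_space_complemented [OF TK cl(1)]
          null_space_complemented_imp_right_invertible_on [OF assms cl(1) image] by (rule iffI [rotated])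
      then show ?thesis
        using True quasi_nilpotent_on_iff_subset_quasi_nilpotent_part [OF assms cl(2) inv] image
        by (auto simp: reduces_def)
    next
      case False
      then show ?thesis
        by (auto simp: reduces_def)
    qed
    then show ?thesis
      by (simp only: ex_simps [symmetric] conj_assoc)
  qed
qed

end
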